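(* Let $n\ge 2$, let $P=\mathbb Z\langle x_1,\dots,x_n,y_1,\dots,y_n\rangle$ be the free associative ring, $r=\sum_{i=1}^n[x_i,y_i]$, and $\Pi=P/(r)$, the quotient by the two-sided ideal generated by $r$. For every prime $p\geq 2$, the classes $r^{(p^\ell)}\in\Pi_{\mathrm{cyc}}$, $\ell\ge 1$, are nonzero and generate the $p$-torsion of the abelian group $\Pi_{\mathrm{cyc}}$. There is no $p^2$-torsion in $\Pi_{\mathrm{cyc}}$ (i.e. no element of order $p^2$).
   Context: For a ring $A$, $A_{\mathrm{cyc}}:=A/[A,A]$, where $[A,A]$ is the $\mathbb Z$-span of all commutators $ab-ba$. Let $\pi:P\to P_{\mathrm{cyc}}$ be the quotient map and $\bar\alpha:P_{\mathrm{cyc}}\to\Pi_{\mathrm{cyc}}$ the map induced by $P\to\Pi$. $P_{\mathrm{cyc}}$ is a free $\mathbb Z$-module (with basis the cyclic words), and for $p$ prime and $\ell\ge1$ the element $\pi(r^{p^\ell})$ is divisible by $p$ in $P_{\mathrm{cyc}}$. One defines $r^{(p^\ell)}:=\bar\alpha\big(\tfrac1p\pi(r^{p^\ell})\big)\in\Pi_{\mathrm{cyc}}$; it satisfies $p\,r^{(p^\ell)}=0$. *)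

theory Defs
  imports
    "HOL-Library.Poly_Mapping"
    "HOL-Computational_Algebra.Primes"
    "HOL-Algebra.QuotRing"
    "HOL-Algebra.Multiplicative_Group"
begin

section \<open>Free associative rings over the integers\<close>

text \<open>
  The library has no noncommutative polynomial ring.  The free associative ring on the set S
  is realised as the free abelian group on the words over S, with the bilinear extension of
  concatenation as multiplication.
\<close>

definition free_mult :: "('a list \<Rightarrow>\<^sub>0 int) \<Rightarrow> ('a list \<Rightarrow>\<^sub>0 int) \<Rightarrow> ('a list \<Rightarrow>\<^sub>0 int)" where
  "free_mult f g = frag_extend (\<lambda>u. frag_extend (\<lambda>v. frag_of (u @ v)) g) f"

definition free_ring :: "'a set \<Rightarrow> ('a list \<Rightarrow>\<^sub>0 int) ring" where
  "free_ring S =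
     \<lparr>carrier = {f. Poly_Mapping.keys f \<subseteq> lists S},
      mult = free_mult, one = frag_of [], zero = 0, add = (+)\<rparr>"

lemma free_mult_of [simp]: "free_mult (frag_of u) (frag_of v) = frag_of (u @ v)"
  by (simp add: free_mult_def)

lemma free_mult_0 [simp]: "free_mult 0 g = 0" "free_mult f 0 = 0"
  by (simp_all add: free_mult_def frag_extend_eq_0)

lemma frag_induct:
  assumes "Q 0" "\<And>x. Q (frag_of x)" "\<And>a b. Q a \<Longrightarrow> Q b \<Longrightarrow> Q (a - b)"
  shows "Q c"
  by (rule frag_induction[of c UNIV]) (use assms in auto)

lemma free_mult_add_left: "free_mult (f + g) h = free_mult f h + free_mult g h"
  by (simp add: free_mult_def frag_extend_add)

lemma free_mult_diff_left: "free_mult (f - g) h = free_mult f h - free_mult g h"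
  by (simp add: free_mult_def frag_extend_diff)

lemma free_mult_add_right: "free_mult f (g + h) = free_mult f g + free_mult f h"
proof (induction f rule: frag_induct)
  case (2 x)
  then show ?case by (simp add: free_mult_def frag_extend_add)
next
  case (3 a b)
  then show ?case by (simp add: free_mult_diff_left)
qed auto

lemma free_mult_diff_right: "free_mult f (g - h) = free_mult f g - free_mult f h"
  by (metis add_diff_cancel_right' diff_add_cancel free_mult_add_right)

lemma free_mult_one [simp]: "free_mult (frag_of []) f = f" "free_mult f (frag_of []) = f"
  by (simp_all add: free_mult_def frag_expansion [symmetric])

lemma free_mult_assoc: "free_mult (free_mult f g) h = free_mult f (free_mult g h)"
proof (induction f rule: frag_induct)
  case (2 u)
  show ?case
  proof (induction g rule: frag_induct)
    case (2 v)
    show ?case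
    proof (induction h rule: frag_induct)
      case (3 a b)
      then show ?case by (simp add: free_mult_diff_right)
    qed auto
  next
    case (3 a b)
    then show ?case by (simp add: free_mult_diff_right free_mult_diff_left)
  qed auto
next
  case (3 a b)
  then show ?case by (simp add: free_mult_diff_left)
qed auto

lemma keys_free_mult:
  assumes "Poly_Mapping.keys f \<subseteq> lists S" "Poly_Mapping.keys g \<subseteq> lists S"
  shows "Poly_Mapping.keys (free_mult f g) \<subseteq> lists S"
proof -
  have "Poly_Mapping.keys (free_mult f g) \<subseteq>
      (\<Union>u\<in>Poly_Mapping.keys f. \<Union>v\<in>Poly_Mapping.keys g. {u @ v})"
    unfolding free_mult_def
    by (rule order_trans[OF keys_frag_extend]) (rule UN_mono[OF order_refl],
        rule order_trans[OF keys_frag_extend], auto)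
  also have "\<dots> \<subseteq> lists S"
    using assms by (fastforce simp: lists_eq_set)
  finally show ?thesis .
qed

lemma ring_free_ring: "ring (free_ring S)"
proof (rule ringI)
  show "abelian_group (free_ring S)"
  proof (rule abelian_groupI)
    fix f assume "f \<in> carrier (free_ring S)"
    then show "\<exists>g\<in>carrier (free_ring S). g \<oplus>\<^bsub>free_ring S\<^esub> f = \<zero>\<^bsub>free_ring S\<^esub>"
      by (intro bexI[of _ "- f"]) (auto simp: free_ring_def)
  qed (auto simp: free_ring_def add.assoc add.commute dest!: set_mp[OF keys_add])
  show "monoid (free_ring S)"
    by (rule monoidI) (auto simp: free_ring_def free_mult_assoc dest: set_mp[OF keys_free_mult, rotated 2])
qed (auto simp: free_ring_def free_mult_add_left free_mult_add_right)

section \<open>The functor taking A to A/[A,A]\<close>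

definition commutator :: "('a, 'm) ring_scheme \<Rightarrow> 'a \<Rightarrow> 'a \<Rightarrow> 'a" where
  "commutator A a b = a \<otimes>\<^bsub>A\<^esub> b \<ominus>\<^bsub>A\<^esub> b \<otimes>\<^bsub>A\<^esub> a"

definition comm_span :: "('a, 'm) ring_scheme \<Rightarrow> 'a set" where
  "comm_span A =
     generate (add_monoid A) {commutator A a b |a b. a \<in> carrier A \<and> b \<in> carrier A}"

text \<open>
  The abelian group \<open>cyc A\<close> is written multiplicatively, as are all quotient groups
  in HOL-Algebra: the multiple \<open>m z\<close> is the power of z with exponent m, and zero is \<open>\<one>\<close>.
\<close>

definition cyc :: "('a, 'm) ring_scheme \<Rightarrow> 'a set monoid" where
  "cyc A = A A_Mod comm_span A"

definition cyc_proj :: "('a, 'm) ring_scheme \<Rightarrow> 'a \<Rightarrow> 'a set" where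
  "cyc_proj A a = comm_span A +>\<^bsub>A\<^esub> a"

definition cyc_map ::
  "('a, 'm) ring_scheme \<Rightarrow> ('b, 'k) ring_scheme \<Rightarrow> ('a \<Rightarrow> 'b) \<Rightarrow> 'a set \<Rightarrow> 'b set" where
  "cyc_map A B h Z = the_elem ((\<lambda>a. cyc_proj B (h a)) ` Z)"

lemma commutator_closed:
  assumes "ring A" "a \<in> carrier A" "b \<in> carrier A"
  shows "commutator A a b \<in> carrier A"
proof -
  interpret ring A by fact
  show ?thesis using assms by (simp add: commutator_def)
qed

lemma abelian_subgroup_comm_span:
  assumes "ring A"
  shows "abelian_subgroup (comm_span A) A"
proof -
  interpret ring A by fact
  have "subgroup (comm_span A) (add_monoid A)"
    unfolding comm_span_def
    by (rule add.generate_is_subgroup) (auto intro: commutator_closed assms)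
  then show ?thesis
    by (intro abelian_subgroupI3 additive_subgroupI) (simp_all add: abelian_group_axioms)
qed

lemma comm_group_cyc: "ring A \<Longrightarrow> comm_group (cyc A)"
  unfolding cyc_def by (intro abelian_subgroup.a_factorgroup_is_comm_group abelian_subgroup_comm_span)

lemma cyc_proj_hom:
  assumes "ring A"
  shows "cyc_proj A \<in> hom (add_monoid A) (cyc A)"
proof -
  interpret abelian_subgroup "comm_span A" A by (rule abelian_subgroup_comm_span[OF assms])
  show ?thesis
    using a_r_coset_hom_A_Mod by (simp add: cyc_def cyc_proj_def[abs_def])
qed

lemma cyc_map_proj:
  assumes "ring A" "ring B" "h \<in> ring_hom A B" "a \<in> carrier A"
  shows "cyc_map A B h (cyc_proj A a) = cyc_proj B (h a)"
proof -
  interpret A: ring A by fact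
  interpret B: ring B by fact
  interpret ring_hom_ring A B h by (rule ring_hom_ringI2) fact+
  interpret SA: abelian_subgroup "comm_span A" A by (rule abelian_subgroup_comm_span[OF assms(1)])
  interpret SB: abelian_subgroup "comm_span B" B by (rule abelian_subgroup_comm_span[OF assms(2)])
  have h_comm: "h (commutator A u v) = commutator B (h u) (h v)"
    if "u \<in> carrier A" "v \<in> carrier A" for u v
    using that by (simp add: commutator_def a_minus_def)
  have *: "h c \<in> comm_span B" if "c \<in> comm_span A" for c
  proof -
    have "h ` comm_span A = generate (add_monoid B)
        (h ` {commutator A a b |a b. a \<in> carrier A \<and> b \<in> carrier A})"
      unfolding comm_span_def
      by (rule group_hom.generate_img[OF a_group_hom, symmetric])
         (auto intro: commutator_closed assms)
    also have "\<dots> \<subseteq> comm_span B"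
      unfolding comm_span_def by (rule B.add.mono_generate) (use h_comm hom_closed in blast)
    finally show ?thesis using that by blast
  qed
  have "cyc_proj B (h z) = cyc_proj B (h a)" if "z \<in> cyc_proj A a" for z
  proof -
    from that obtain c where c: "c \<in> comm_span A" "z = c \<oplus>\<^bsub>A\<^esub> a"
      by (auto simp: cyc_proj_def a_r_coset_def')
    then have "h z \<in> cyc_proj B (h a)"
      using *[of c] SA.a_Hcarr[of c] assms(4) by (auto simp: cyc_proj_def a_r_coset_def')
    then show ?thesis
      using B.a_repr_independence[OF _ _ SB.a_subgroup] assms(4)
      by (simp add: cyc_proj_def)
  qed
  moreover have "a \<in> cyc_proj A a"
    using SA.a_rcos_self assms(4) by (simp add: cyc_proj_def)
  ultimately have "(\<lambda>z. cyc_proj B (h z)) ` cyc_proj A a = {cyc_proj B (h a)}"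
    by blast
  then show ?thesis by (simp add: cyc_map_def)
qed

section \<open>The preprojective algebra and its torsion classes\<close>

datatype letter = Xvar nat | Yvar nat

definition P_ring :: "nat \<Rightarrow> (letter list \<Rightarrow>\<^sub>0 int) ring" where
  "P_ring n = free_ring (Xvar ` {1..n} \<union> Yvar ` {1..n})"

definition r_elem :: "nat \<Rightarrow> letter list \<Rightarrow>\<^sub>0 int" where
  "r_elem n = (\<Oplus>\<^bsub>P_ring n\<^esub>i\<in>{1..n}. commutator (P_ring n) (frag_of [Xvar i]) (frag_of [Yvar i]))"

definition Pi_ring :: "nat \<Rightarrow> (letter list \<Rightarrow>\<^sub>0 int) set ring" where
  "Pi_ring n = P_ring n Quot (Idl\<^bsub>P_ring n\<^esub> {r_elem n})"

definition Pi_proj :: "nat \<Rightarrow> (letter list \<Rightarrow>\<^sub>0 int) \<Rightarrow> (letter list \<Rightarrow>\<^sub>0 int) set" where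
  "Pi_proj n a = Idl\<^bsub>P_ring n\<^esub> {r_elem n} +>\<^bsub>P_ring n\<^esub> a"

text \<open>
  The quotient of \<open>\<pi>(r^(p^l))\<close> by p is unique because \<open>cyc (P_ring n)\<close> is a free abelian group,
  and exists for p prime and \<open>l \<ge> 1\<close>; the definition is meant for such p and l only.
\<close>

definition r_class :: "nat \<Rightarrow> nat \<Rightarrow> nat \<Rightarrow> (letter list \<Rightarrow>\<^sub>0 int) set set" where
  "r_class n p l =
     cyc_map (P_ring n) (Pi_ring n) (Pi_proj n)
       (THE z. z \<in> carrier (cyc (P_ring n)) \<and>
               z [^]\<^bsub>cyc (P_ring n)\<^esub> p = cyc_proj (P_ring n) (r_elem n [^]\<^bsub>P_ring n\<^esub> (p ^ l)))"

lemma ring_P_ring: "ring (P_ring n)"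
  by (simp add: P_ring_def ring_free_ring)

lemma r_elem_closed: "r_elem n \<in> carrier (P_ring n)"
proof -
  interpret ring "P_ring n" by (rule ring_P_ring)
  show ?thesis
    unfolding r_elem_def
    by (intro finsum_closed Pi_I commutator_closed ring_P_ring) (auto simp: P_ring_def free_ring_def)
qed

lemma r_elem_eq: "r_elem n = (\<Sum>i=1..n. frag_of [Xvar i, Yvar i] - frag_of [Yvar i, Xvar i])"
proof -
  interpret ring "P_ring n" by (rule ring_P_ring)
  have gen: "frag_of [Xvar i] \<in> carrier (P_ring n)" "frag_of [Yvar i] \<in> carrier (P_ring n)"
    if "i \<in> {1..n}" for i
    using that by (auto simp: P_ring_def free_ring_def)
  have minus: "f \<ominus>\<^bsub>P_ring n\<^esub> g = f - g"
    if "f \<in> carrier (P_ring n)" "g \<in> carrier (P_ring n)" for f g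
  proof -
    have "f - g \<in> carrier (P_ring n)"
      using that keys_diff[of f g] by (auto simp: P_ring_def free_ring_def)
    moreover have "f = (f - g) \<oplus>\<^bsub>P_ring n\<^esub> g"
      by (simp add: P_ring_def free_ring_def)
    ultimately show ?thesis
      using that by (metis a_assoc a_minus_def r_neg r_zero a_inv_closed)
  qed
  have comm: "commutator (P_ring n) (frag_of [Xvar i]) (frag_of [Yvar i]) =
      frag_of [Xvar i, Yvar i] - frag_of [Yvar i, Xvar i]" if "i \<in> {1..n}" for i
  proof -
    have "frag_of [Xvar i] \<otimes>\<^bsub>P_ring n\<^esub> frag_of [Yvar i] = frag_of [Xvar i, Yvar i]"
      "frag_of [Yvar i] \<otimes>\<^bsub>P_ring n\<^esub> frag_of [Xvar i] = frag_of [Yvar i, Xvar i]"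
      by (simp_all add: P_ring_def free_ring_def)
    with gen[OF that] show ?thesis
      unfolding commutator_def by (metis minus m_closed)
  qed
  have "(\<Oplus>\<^bsub>P_ring n\<^esub>i\<in>I. commutator (P_ring n) (frag_of [Xvar i]) (frag_of [Yvar i])) =
      (\<Sum>i\<in>I. frag_of [Xvar i, Yvar i] - frag_of [Yvar i, Xvar i])"
    if "finite I" "I \<subseteq> {1..n}" for I
    using that
  proof (induction I rule: finite_induct)
    case empty
    have "\<zero>\<^bsub>P_ring n\<^esub> = 0" by (simp add: P_ring_def free_ring_def)
    then show ?case by simp
  next
    case (insert j I)
    have c: "commutator (P_ring n) (frag_of [Xvar i]) (frag_of [Yvar i]) \<in> carrier (P_ring n)"
      if "i \<in> insert j I" for i
      using that insert.prems gen by (intro commutator_closed ring_P_ring) auto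
    have add: "f \<oplus>\<^bsub>P_ring n\<^esub> g = f + g" for f g
      by (simp add: P_ring_def free_ring_def)
    show ?case
      using insert.hyps insert.prems c insert.IH comm[of j]
      by (metis (no_types, lifting) Pi_I add finsum_insert insertCI insert_subset sum.insert)
  qed
  then show ?thesis by (simp add: r_elem_def)
qed

lemma ring_Pi_ring: "ring (Pi_ring n)"
  unfolding Pi_ring_def
  by (intro ideal.quotient_is_ring ring.genideal_ideal ring_P_ring) (simp add: r_elem_closed)

lemma Pi_proj_hom: "Pi_proj n \<in> ring_hom (P_ring n) (Pi_ring n)"
proof -
  interpret ideal "Idl\<^bsub>P_ring n\<^esub> {r_elem n}" "P_ring n"
    by (intro ring.genideal_ideal ring_P_ring) (simp add: r_elem_closed)
  show ?thesis
    using rcos_ring_hom by (simp add: Pi_ring_def Pi_proj_def[abs_def])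
qed

end

theory Submission
  imports Defs
begin

text \<open>
  \<open>\<Pi>\<^sub>c\<^sub>y\<^sub>c\<close> is the cokernel of \<open>\<phi> : P \<rightarrow> P\<^sub>c\<^sub>y\<^sub>c, f \<mapsto> \<pi>(f r)\<close>, so its p-torsion is governed by the f with
  \<open>\<phi>(f) \<equiv> 0\<close> modulo p, and the absence of \<open>p\<^sup>2\<close>-torsion by the f with \<open>\<phi>(f) \<equiv> 0\<close> modulo \<open>p\<^sup>2\<close>.

  Write \<open>r = r\<^sub>1 + c\<close> with \<open>r\<^sub>1 = [x\<^sub>1, y\<^sub>1]\<close>. On cyclic words containing a letter other than
  \<open>x\<^sub>1, y\<^sub>1\<close>, the rewriting rule \<open>x\<^sub>1 y\<^sub>1 \<rightarrow> y\<^sub>1 x\<^sub>1 - c\<close> is confluent; it splits off the image under \<open>\<phi>\<close> of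
  the words with such a letter, which therefore contributes no torsion. The part of f in \<open>x\<^sub>1, y\<^sub>1\<close>
  alone is a combination of products \<open>b\<^sub>1 r\<^sub>1 b\<^sub>2 r\<^sub>1 \<dots> r\<^sub>1 b\<^sub>m\<close> with normal words \<open>b\<^sub>i\<close>. As \<open>r\<^sub>1 = r - c\<close>,
  the reduction of \<open>\<phi>(f)\<close> is, up to signs, the same combination of the cyclic elements
  \<open>b\<^sub>1 c b\<^sub>2 c \<dots> b\<^sub>m c\<close>, and these are linearly independent up to cyclic rotation of the tuples
  \<open>(b\<^sub>1, \<dots>, b\<^sub>m)\<close>, at least when the \<open>b\<^sub>i\<close> are not all empty. Since
  \<open>\<pi>(b\<^sub>1 r b\<^sub>2 r \<dots> b\<^sub>m r)\<close> is invariant under such rotations, only the tuples of empty words matter, that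
  is, the multiples \<open>\<lambda>\<^sub>m r\<^sup>m\<^sup>-\<^sup>1\<close>. For them the cyclic words in \<open>\<pi>(r\<^sub>1\<^sup>m)\<close> with exactly j rotations show that
  \<open>j \<lambda>\<^sub>m \<equiv> 0\<close> for every prime divisor j of m, which leaves only powers of p modulo p, and forces
  p to divide the coefficients there modulo \<open>p\<^sup>2\<close>.
\<close>

section \<open>Linearity of the concatenation product\<close>

section \<open>Free associative rings\<close>

notation free_mult (infixl "\<star>" 70)

lemmas frag_extend_linear = frag_extend_add frag_extend_diff frag_extend_minus frag_extend_cmul
lemmas free_mult_linear =
  free_mult_add_left free_mult_add_right free_mult_diff_left free_mult_diff_right

lemma free_mult_minus_left: "(- f) \<star> g = - (f \<star> g)"
  using free_mult_diff_left[of 0 f g] by simp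

lemma free_mult_minus_right: "f \<star> (- g) = - (f \<star> g)"
  using free_mult_diff_right[of f 0 g] by simp

lemma free_mult_cmul_left: "frag_cmul k f \<star> g = frag_cmul k (f \<star> g)"
  by (simp add: free_mult_def frag_extend_cmul)

lemma frag_cmul_diff_distrib2: "frag_cmul k (f - g) = frag_cmul k f - frag_cmul k g"
  by (rule poly_mapping_eqI) (simp add: lookup_minus right_diff_distrib)

lemma free_mult_cmul_right: "f \<star> frag_cmul k g = frag_cmul k (f \<star> g)"
proof (induction f rule: frag_induct)
  case (2 u)
  then show ?case by (simp add: free_mult_def frag_extend_cmul)
next
  case (3 a b)
  then show ?case by (simp add: free_mult_diff_left frag_cmul_diff_distrib2)
qed simp

lemma free_mult_sum_left: "sum F I \<star> g = (\<Sum>i\<in>I. F i \<star> g)"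
  by (induction I rule: infinite_finite_induct) (simp_all add: free_mult_add_left)

lemma free_mult_sum_right: "g \<star> sum F I = (\<Sum>i\<in>I. g \<star> F i)"
  by (induction I rule: infinite_finite_induct) (simp_all add: free_mult_add_right)

lemma free_mult_of_assoc [simp]: "frag_of u \<star> (frag_of v \<star> f) = frag_of (u @ v) \<star> f"
  by (simp flip: free_mult_assoc)

lemma frag_extend_sum': "frag_extend f (sum g I) = (\<Sum>i\<in>I. frag_extend f (g i))"
  by (induction I rule: infinite_finite_induct) (simp_all add: frag_extend_add)

lemma frag_extend_frag_extend:
  "frag_extend F (frag_extend G f) = frag_extend (\<lambda>x. frag_extend F (G x)) f"
  by (induction f rule: frag_induct) (simp_all add: frag_extend_diff)

section \<open>Cyclic words and the free abelian group on them\<close>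

section \<open>Rotation classes\<close>

definition rot_class :: "'a list \<Rightarrow> 'a list set" where
  "rot_class w = range (\<lambda>k. rotate k w)"

lemma mem_rot_class_iff: "w' \<in> rot_class w \<longleftrightarrow> (\<exists>u v. w = u @ v \<and> w' = v @ u)"
proof
  assume "w' \<in> rot_class w"
  then obtain k where "w' = rotate k w" by (auto simp: rot_class_def)
  then show "\<exists>u v. w = u @ v \<and> w' = v @ u"
    by (metis append_take_drop_id rotate_drop_take)
next
  assume "\<exists>u v. w = u @ v \<and> w' = v @ u"
  then show "w' \<in> rot_class w"
    by (metis rangeI rot_class_def rotate_append)
qed

lemma self_in_rot_class [simp]: "w \<in> rot_class w"
  by (metis append.right_neutral append_Nil mem_rot_class_iff)

lemma rot_class_append: "rot_class (u @ v) = rot_class (v @ u)"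
proof -
  have "rot_class (v @ u) \<subseteq> rot_class (u @ v)" for u v :: "'a list"
  proof
    fix w assume "w \<in> rot_class (v @ u)"
    then obtain k where "w = rotate k (v @ u)" by (auto simp: rot_class_def)
    then have "w = rotate (k + length u) (u @ v)"
      by (simp add: rotate_append flip: rotate_rotate)
    then show "w \<in> rot_class (u @ v)" by (auto simp: rot_class_def)
  qed
  then show ?thesis by blast
qed

lemma rot_class_eq: "w' \<in> rot_class w \<Longrightarrow> rot_class w' = rot_class w"
  by (auto simp: mem_rot_class_iff rot_class_append)

lemma rot_class_eq_iff: "rot_class w = rot_class w' \<longleftrightarrow> w \<in> rot_class w'"
  using rot_class_eq self_in_rot_class by blast

lemma set_rot_class: "w' \<in> rot_class w \<Longrightarrow> set w' = set w"
  by (auto simp: rot_class_def)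

lemma length_rot_class: "w' \<in> rot_class w \<Longrightarrow> length w' = length w"
  by (auto simp: rot_class_def)

definition rot_inv :: "('a list \<Rightarrow> 'b) \<Rightarrow> bool" where
  "rot_inv g \<longleftrightarrow> (\<forall>u v. g (u @ v) = g (v @ u))"

lemma rot_invI: "(\<And>u v. g (u @ v) = g (v @ u)) \<Longrightarrow> rot_inv g"
  by (simp add: rot_inv_def)

lemma rot_invD: "rot_inv g \<Longrightarrow> w' \<in> rot_class w \<Longrightarrow> g w' = g w"
  by (auto simp: rot_inv_def mem_rot_class_iff)

lemma rot_inv_rot_class_fun: "rot_inv (\<lambda>w. F (rot_class w))"
  by (rule rot_invI) (simp add: rot_class_append)

text \<open>The quotient map \<pi> in concrete form: on P its kernel is the span of the commutators
  (\<open>comm_span_P\<close>), so coefficients and divisibility in P_cyc can be read off.\<close>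

definition cy :: "('a list \<Rightarrow>\<^sub>0 int) \<Rightarrow> ('a list set \<Rightarrow>\<^sub>0 int)" where
  "cy = frag_extend (\<lambda>w. frag_of (rot_class w))"

lemma cy_of [simp]: "cy (frag_of w) = frag_of (rot_class w)"
  and cy_0 [simp]: "cy 0 = 0"
  by (simp_all add: cy_def)

lemma cy_add: "cy (f + g) = cy f + cy g"
  and cy_diff: "cy (f - g) = cy f - cy g"
  and cy_minus: "cy (- f) = - cy f"
  and cy_cmul: "cy (frag_cmul k f) = frag_cmul k (cy f)"
  by (simp_all add: cy_def frag_extend_linear)

lemma cy_sum: "cy (sum F I) = (\<Sum>i\<in>I. cy (F i))"
  by (simp add: cy_def frag_extend_sum')

lemma cy_frag_extend: "cy (frag_extend F f) = frag_extend (\<lambda>x. cy (F x)) f"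
  by (simp add: cy_def frag_extend_frag_extend)

lemmas cy_linear = cy_add cy_diff cy_minus cy_cmul

text \<open>Every rotation-invariant function of words factors linearly through \<open>cy\<close>.\<close>

definition on_classes :: "('a list \<Rightarrow> 'b) \<Rightarrow> 'a list set \<Rightarrow> 'b" where
  "on_classes g C = g (SOME w. w \<in> C)"

lemma on_classes: "rot_inv g \<Longrightarrow> on_classes g (rot_class w) = g w"
  unfolding on_classes_def by (metis rot_invD self_in_rot_class someI)

lemma frag_extend_rot_inv:
  assumes "rot_inv g"
  shows "frag_extend g f = frag_extend (on_classes g) (cy f)"
  by (induction f rule: frag_induct)
    (simp_all add: frag_extend_linear cy_linear on_classes[OF assms])

lemma frag_extend_rot_inv_cong:
  "rot_inv g \<Longrightarrow> cy f = cy f' \<Longrightarrow> frag_extend g f = frag_extend g f'"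
  by (simp add: frag_extend_rot_inv)

lemma cy_mult_commute: "cy (f \<star> g) = cy (g \<star> f)"
proof (induction f rule: frag_induct)
  case (2 u)
  show ?case
    by (induction g rule: frag_induct) (simp_all add: free_mult_linear cy_linear rot_class_append)
qed (simp_all add: free_mult_linear cy_linear)

lemma frag_extend_rot_inv_commute:
  "rot_inv g \<Longrightarrow> frag_extend g (f \<star> h) = frag_extend g (h \<star> f)"
  by (rule frag_extend_rot_inv_cong[OF _ cy_mult_commute])

text \<open>Choosing a word in each class gives \<open>?R\<close> with
  \<open>cy (?R (cy f)) = cy f\<close>. The given \<open>h\<close> may involve sets that are no
  rotation classes; \<open>?R\<close> followed by \<open>cy\<close> moves it into the image of
  \<open>cy\<close>.\<close>

lemma cy_lift:
  assumes "cy f = frag_cmul N h"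
  obtains f' where "cy f = frag_cmul N (cy f')"
proof
  let ?R = "frag_extend (on_classes frag_of) :: _ \<Rightarrow> 'a list \<Rightarrow>\<^sub>0 int"
  have "cy (?R (cy f)) = cy f" for f :: "'a list \<Rightarrow>\<^sub>0 int"
  proof (induction f rule: frag_induct)
    case (2 w)
    have "(SOME x. x \<in> rot_class w) \<in> rot_class w" by (rule someI[of _ w]) simp
    then show ?case by (simp add: on_classes_def rot_class_eq)
  qed (simp_all add: frag_extend_linear cy_linear)
  from this[of f] show "cy f = frag_cmul N (cy (?R h))"
    by (simp add: assms frag_extend_linear cy_linear)
qed

section \<open>Divisibility by an integer in free abelian groups\<close>

section \<open>Congruences modulo an integer\<close>

definition fdvd :: "int \<Rightarrow> ('a \<Rightarrow>\<^sub>0 int) \<Rightarrow> bool" where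
  "fdvd N f \<longleftrightarrow> (\<exists>h. f = frag_cmul N h)"

lemma fdvdI: "f = frag_cmul N h \<Longrightarrow> fdvd N f"
  by (auto simp: fdvd_def)

lemma fdvd_0 [simp]: "fdvd N 0"
  by (rule fdvdI[of _ _ 0]) simp

lemma fdvd_diff: "fdvd N f \<Longrightarrow> fdvd N g \<Longrightarrow> fdvd N (f - g)"
  by (auto simp: fdvd_def simp flip: frag_cmul_diff_distrib2)

lemma fdvd_minus: "fdvd N f \<Longrightarrow> fdvd N (- f)"
  using fdvd_diff[of N 0 f] by simp

lemma fdvd_minus_iff: "fdvd N (- f) \<longleftrightarrow> fdvd N f"
  using fdvd_minus by fastforce

lemma fdvd_add: "fdvd N f \<Longrightarrow> fdvd N g \<Longrightarrow> fdvd N (f + g)"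
  using fdvd_diff[of N f "- g"] fdvd_minus by force

lemma fdvd_cmul [simp]: "fdvd N (frag_cmul N f)"
  by (auto simp: fdvd_def)

lemma fdvd_cmul_dvd: "N dvd k \<Longrightarrow> fdvd N (frag_cmul k f)"
  by (elim dvdE) (simp flip: frag_cmul_cmul)

lemma fdvd_frag_extend: "fdvd N f \<Longrightarrow> fdvd N (frag_extend F f)"
  by (auto simp: fdvd_def frag_extend_cmul)

lemma fdvd_sum: "(\<And>i. i \<in> I \<Longrightarrow> fdvd N (F i)) \<Longrightarrow> fdvd N (sum F I)"
  by (induction I rule: infinite_finite_induct) (simp_all add: fdvd_add)

lemma fdvd_lookup: "fdvd N f \<Longrightarrow> N dvd Poly_Mapping.lookup f x"
  by (auto simp: fdvd_def)

lemma fdvd_rot_inv: "rot_inv g \<Longrightarrow> fdvd N (cy f) \<Longrightarrow> fdvd N (frag_extend g f)"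
  by (simp add: frag_extend_rot_inv fdvd_frag_extend)

lemma fdvd_cy_lift:
  assumes "fdvd N (cy f)"
  obtains f' where "cy f = frag_cmul N (cy f')"
  using assms cy_lift by (metis fdvd_def)

section \<open>The ring homomorphism killing the letters outside a set\<close>

section \<open>Restriction to sub-alphabets\<close>

definition restr :: "'a set \<Rightarrow> ('a list \<Rightarrow>\<^sub>0 int) \<Rightarrow> ('a list \<Rightarrow>\<^sub>0 int)" where
  "restr S = frag_extend (\<lambda>w. if set w \<subseteq> S then frag_of w else 0)"

lemma restr_of: "restr S (frag_of w) = (if set w \<subseteq> S then frag_of w else 0)"
  and restr_0 [simp]: "restr S 0 = 0"
  by (simp_all add: restr_def)

lemma restr_add: "restr S (f + g) = restr S f + restr S g"
  and restr_diff: "restr S (f - g) = restr S f - restr S g"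
  and restr_minus: "restr S (- f) = - restr S f"
  and restr_cmul: "restr S (frag_cmul k f) = frag_cmul k (restr S f)"
  by (simp_all add: restr_def frag_extend_linear)

lemma restr_sum: "restr S (sum F I) = (\<Sum>i\<in>I. restr S (F i))"
  by (simp add: restr_def frag_extend_sum')

lemmas restr_linear = restr_add restr_diff restr_minus restr_cmul

lemma restr_mult: "restr S (f \<star> g) = restr S f \<star> restr S g"
proof (induction f rule: frag_induct)
  case (2 u)
  show ?case
    by (induction g rule: frag_induct) (simp_all add: free_mult_linear restr_linear restr_of)
qed (simp_all add: free_mult_linear restr_linear)

text \<open>Rotation preserves the set of letters of a word, so the projection descends to cyclic
  words.\<close>

lemma restr_cy_cong:
  assumes "cy f = cy g"
  shows "cy (restr S f) = cy (restr S g)"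
proof -
  have "rot_inv (\<lambda>w. cy (if set w \<subseteq> S then frag_of w else 0))"
    by (rule rot_invI) (auto simp: rot_class_append)
  then show ?thesis
    unfolding restr_def cy_frag_extend using assms by (rule frag_extend_rot_inv_cong)
qed

lemma restr_cy_fdvd:
  assumes "fdvd N (cy f)"
  shows "fdvd N (cy (restr S f))"
proof -
  have "rot_inv (\<lambda>w. cy (if set w \<subseteq> S then frag_of w else 0))"
    by (rule rot_invI) (auto simp: rot_class_append)
  then show ?thesis
    unfolding restr_def cy_frag_extend using assms by (rule fdvd_rot_inv)
qed

lemma restr_id: "Poly_Mapping.keys f \<subseteq> lists S \<Longrightarrow> restr S f = f"
  by (induction rule: frag_induction) (auto simp: restr_linear restr_of)

lemma keys_restr: "Poly_Mapping.keys (restr S f) \<subseteq> lists S"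
  unfolding restr_def by (rule order_trans[OF keys_frag_extend]) (auto split: if_splits)

lemma restr_restr [simp]: "restr S (restr S f) = restr S f"
  by (simp add: restr_id keys_restr)

lemma keys_restr_compl: "Poly_Mapping.keys (f - restr S f) \<subseteq> {w. \<not> set w \<subseteq> S}"
proof (induction f rule: frag_induct)
  case (3 a b)
  have "a - b - restr S (a - b) = (a - restr S a) - (b - restr S b)"
    by (simp add: restr_linear)
  then show ?case using 3 keys_diff[of "a - restr S a" "b - restr S b"] by (metis (no_types, lifting) Un_subset_iff order_trans sup.absorb2)
qed (auto simp: restr_of)

lemma keys_compl_if_restr_0: "restr S f = 0 \<Longrightarrow> Poly_Mapping.keys f \<subseteq> {w. \<not> set w \<subseteq> S}"
  using keys_restr_compl[of f S] by simp

section \<open>The decomposition r = r_1 + c and the rewriting of x_1 y_1\<close>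

section \<open>Normal forms modulo the relation\<close>

definition rpart :: "nat \<Rightarrow> letter list \<Rightarrow>\<^sub>0 int" where
  "rpart i = frag_of [Xvar i, Yvar i] - frag_of [Yvar i, Xvar i]"

definition rtail :: "nat \<Rightarrow> letter list \<Rightarrow>\<^sub>0 int" where
  "rtail n = (\<Sum>i=2..n. rpart i)"

lemma r_elem_split: "n \<ge> 1 \<Longrightarrow> r_elem n = rpart 1 + rtail n"
  by (simp add: r_elem_eq rtail_def rpart_def sum.atLeast_Suc_atMost numeral_2_eq_2)

definition xy :: "letter set" where "xy = {Xvar 1, Yvar 1}"

lemma restr_xy_rpart: "restr xy (rpart i) = (if i = 1 then rpart 1 else 0)"
  by (auto simp: rpart_def restr_linear restr_of xy_def)

lemma restr_xy_rtail: "restr xy (rtail n) = 0"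
  by (simp add: rtail_def restr_sum restr_xy_rpart)

lemma restr_xy_r_elem: "n \<ge> 1 \<Longrightarrow> restr xy (r_elem n) = rpart 1"
  by (simp add: r_elem_split restr_linear restr_xy_rpart restr_xy_rtail)

text \<open>
  Words are reduced by the rule \<open>x\<^sub>1 y\<^sub>1 \<rightarrow> y\<^sub>1 x\<^sub>1 - \<Sum>\<^sub>i\<^sub>\<ge>\<^sub>2 [x\<^sub>i, y\<^sub>i]\<close>, whose left-hand sides do not
  overlap; \<open>xmul n v\<close> is the normal form of \<open>x\<^sub>1 v\<close> for a normal word v.
\<close>

fun xmul :: "nat \<Rightarrow> letter list \<Rightarrow> letter list \<Rightarrow>\<^sub>0 int" where
  "xmul n [] = frag_of [Xvar 1]"
| "xmul n (a # v) = (if a = Yvar 1 then frag_of [a] \<star> xmul n v - rtail n \<star> frag_of v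
                     else frag_of (Xvar 1 # a # v))"

text \<open>Left multiplication on normal words: only a new leading x_1 can create an occurrence of
  x_1 y_1.\<close>

definition lmul :: "nat \<Rightarrow> letter \<Rightarrow> (letter list \<Rightarrow>\<^sub>0 int) \<Rightarrow> letter list \<Rightarrow>\<^sub>0 int" where
  "lmul n a f = (if a = Xvar 1 then frag_extend (xmul n) f else frag_of [a] \<star> f)"

fun nfw :: "nat \<Rightarrow> letter list \<Rightarrow> letter list \<Rightarrow>\<^sub>0 int" where
  "nfw n [] = frag_of []"
| "nfw n (a # v) = lmul n a (nfw n v)"

definition nf :: "nat \<Rightarrow> (letter list \<Rightarrow>\<^sub>0 int) \<Rightarrow> letter list \<Rightarrow>\<^sub>0 int" where
  "nf n = frag_extend (nfw n)"

lemma nf_add: "nf n (f + g) = nf n f + nf n g"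
  and nf_diff: "nf n (f - g) = nf n f - nf n g"
  and nf_minus: "nf n (- f) = - nf n f"
  and nf_cmul: "nf n (frag_cmul k f) = frag_cmul k (nf n f)"
  and nf_0 [simp]: "nf n 0 = 0"
  and nf_of: "nf n (frag_of w) = nfw n w"
  by (simp_all add: nf_def frag_extend_linear)

lemma nf_sum: "nf n (sum F I) = (\<Sum>i\<in>I. nf n (F i))"
  by (simp add: nf_def frag_extend_sum')

lemmas nf_linear = nf_add nf_diff nf_minus nf_cmul

lemma lmul_add: "lmul n a (f + g) = lmul n a f + lmul n a g"
  and lmul_diff: "lmul n a (f - g) = lmul n a f - lmul n a g"
  and lmul_minus: "lmul n a (- f) = - lmul n a f"
  and lmul_0 [simp]: "lmul n a 0 = 0"
  by (simp_all add: lmul_def frag_extend_linear free_mult_linear free_mult_minus_right)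

lemmas lmul_linear = lmul_add lmul_diff lmul_minus

lemma nf_letter: "nf n (frag_of [a] \<star> f) = lmul n a (nf n f)"
  by (induction f rule: frag_induct) (simp_all add: nf_linear lmul_linear free_mult_linear nf_of)

lemma nf_word_eq_0: "nf n f = 0 \<Longrightarrow> nf n (frag_of u \<star> f) = 0"
proof (induction u)
  case (Cons a u)
  have "frag_of (a # u) \<star> f = frag_of [a] \<star> (frag_of u \<star> f)" by simp
  then show ?case using Cons by (metis lmul_0 nf_letter)
qed simp

lemma nf_rpart_left: "i \<noteq> 1 \<Longrightarrow> nf n (rpart i \<star> f) = rpart i \<star> nf n f"
proof -
  assume i: "i \<noteq> 1"
  have *: "frag_of [a, b] \<star> g = frag_of [a] \<star> (frag_of [b] \<star> g)" for a b :: letter and g by simp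
  from i show ?thesis
    unfolding rpart_def free_mult_linear nf_linear * nf_letter by (simp add: lmul_def)
qed

lemma nf_rtail_left: "nf n (rtail m \<star> f) = rtail m \<star> nf n f"
  by (simp add: rtail_def free_mult_sum_left nf_sum nf_rpart_left)

text \<open>Prepending x_1 and y_1 gives operators X and Y with X Y - Y X + c = 0, which is the
  clause of \<open>xmul\<close> for a leading y_1; the letters of c act by plain
  multiplication.\<close>

lemma nf_r_left:
  assumes "n \<ge> 1"
  shows "nf n (r_elem n \<star> f) = 0"
proof -
  have key: "lmul n (Xvar 1) (lmul n (Yvar 1) g) - lmul n (Yvar 1) (lmul n (Xvar 1) g) + rtail n \<star> g = 0"
    for g
  proof (induction g rule: frag_induct)
    case (3 a b)
    let ?E = "\<lambda>g. lmul n (Xvar 1) (lmul n (Yvar 1) g) - lmul n (Yvar 1) (lmul n (Xvar 1) g) + rtail n \<star> g"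
    have "?E (a - b) = ?E a - ?E b"
      by (simp add: lmul_linear free_mult_linear algebra_simps)
    then show ?case using 3 by simp
  qed (simp_all add: lmul_def free_mult_linear)
  have *: "frag_of [a, b] \<star> g = frag_of [a] \<star> (frag_of [b] \<star> g)" for a b :: letter and g by simp
  show ?thesis
    using key[of "nf n f"]
    unfolding r_elem_split[OF assms] rpart_def free_mult_linear nf_linear nf_rtail_left * nf_letter .
qed

lemma nf_r: "n \<ge> 1 \<Longrightarrow> nf n (f \<star> (r_elem n \<star> g)) = 0"
proof (induction f rule: frag_induct)
  case (2 u)
  then show ?case by (simp add: nf_word_eq_0 nf_r_left del: free_mult_of_assoc)
qed (simp_all add: free_mult_linear nf_linear)

text \<open>Rewriting moves x_1 only across y_1, so any letter outside \<open>xy\<close> stops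
  it.\<close>

lemma xmul_append: "o' \<notin> xy \<Longrightarrow> xmul n (v @ o' # w) = xmul n v \<star> frag_of (o' # w)"
  by (induction v) (auto simp: xy_def free_mult_linear free_mult_assoc)

lemma lmul_append:
  assumes "o' \<notin> xy"
  shows "lmul n a (f \<star> (frag_of [o'] \<star> g)) = lmul n a f \<star> (frag_of [o'] \<star> g)"
proof (induction f rule: frag_induct)
  case (2 u)
  show ?case
  proof (induction g rule: frag_induct)
    case (2 w)
    then show ?case by (simp add: lmul_def xmul_append[OF assms] free_mult_assoc)
  qed (simp_all add: free_mult_linear lmul_linear)
qed (simp_all add: free_mult_linear lmul_linear)

text \<open>No occurrence of x_1 y_1 contains \<open>o'\<close>, and no x_1 from the left moves past
  it, so the two sides are reduced independently.\<close>

lemma nf_split: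
  assumes "o' \<notin> xy"
  shows "nf n (f \<star> (frag_of [o'] \<star> g)) = nf n f \<star> (frag_of [o'] \<star> nf n g)"
proof (induction f rule: frag_induct)
  case (2 u)
  show ?case
  proof (induction u)
    case Nil
    then show ?case using assms by (simp add: nf_letter lmul_def nf_of xy_def)
  next
    case (Cons a u)
    have "frag_of (a # u) \<star> (frag_of [o'] \<star> g) = frag_of [a] \<star> (frag_of u \<star> (frag_of [o'] \<star> g))"
      by simp
    then have "nf n (frag_of (a # u) \<star> (frag_of [o'] \<star> g)) =
        lmul n a (nf n (frag_of u) \<star> (frag_of [o'] \<star> nf n g))"
      using Cons by (metis nf_letter)
    also have "\<dots> = nf n (frag_of (a # u)) \<star> (frag_of [o'] \<star> nf n g)"
      by (simp only: lmul_append[OF assms] nf_of nfw.simps)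
    finally show ?case .
  qed
qed (simp_all add: free_mult_linear nf_linear)

text \<open>One rewriting step inside u x_1 y_1 v changes the word by u r v, which is cyclically v u
  r and so lies in the image of \<phi>. The left factor \<open>u\<close> is arbitrary in order to
  absorb each y_1 that x_1 has passed.\<close>

lemma xmul_mod_r:
  assumes "n \<ge> 1"
  shows "\<exists>G. cy (u \<star> (frag_of [Xvar 1] \<star> g - frag_extend (xmul n) g)) = cy (G \<star> r_elem n)"
proof (induction g rule: frag_induct)
  case 1
  show ?case by (rule exI[of _ 0]) simp
next
  case (3 a b)
  then obtain G H where "cy (u \<star> (frag_of [Xvar 1] \<star> a - frag_extend (xmul n) a)) = cy (G \<star> r_elem n)"
    "cy (u \<star> (frag_of [Xvar 1] \<star> b - frag_extend (xmul n) b)) = cy (H \<star> r_elem n)" by blast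
  then show ?case
    by (intro exI[of _ "G - H"]) (simp add: free_mult_linear cy_linear frag_extend_linear algebra_simps)
next
  case (2 v)
  show ?case
  proof (induction v arbitrary: u)
    case Nil
    show ?case by (rule exI[of _ 0]) simp
  next
    case (Cons a v)
    show ?case
    proof (cases "a = Yvar 1")
      case False
      then show ?thesis by (intro exI[of _ 0]) simp
    next
      case True
      obtain G where G: "cy (u \<star> frag_of [Yvar 1] \<star> (frag_of [Xvar 1] \<star> frag_of v - frag_extend (xmul n) (frag_of v))) =
          cy (G \<star> r_elem n)" using Cons by blast
      have "u \<star> (frag_of [Xvar 1] \<star> frag_of (a # v) - frag_extend (xmul n) (frag_of (a # v))) =
        u \<star> (r_elem n \<star> frag_of v) +
        u \<star> frag_of [Yvar 1] \<star> (frag_of [Xvar 1] \<star> frag_of v - frag_extend (xmul n) (frag_of v))"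
        unfolding r_elem_split[OF assms] rpart_def using True
        by (simp add: free_mult_linear free_mult_assoc algebra_simps)
      moreover have "cy (u \<star> (r_elem n \<star> frag_of v)) = cy (frag_of v \<star> u \<star> r_elem n)"
        by (metis cy_mult_commute free_mult_assoc)
      ultimately show ?thesis
        using G by (intro exI[of _ "frag_of v \<star> u + G"]) (simp add: cy_linear free_mult_linear)
    qed
  qed
qed

lemma nf_mod_r:
  assumes "n \<ge> 1"
  shows "\<exists>G. cy (u \<star> (f - nf n f)) = cy (G \<star> r_elem n)"
proof (induction f rule: frag_induct)
  case 1
  show ?case by (rule exI[of _ 0]) simp
next
  case (3 a b)
  then obtain G H where "cy (u \<star> (a - nf n a)) = cy (G \<star> r_elem n)"
    "cy (u \<star> (b - nf n b)) = cy (H \<star> r_elem n)" by blast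
  then show ?case
    by (intro exI[of _ "G - H"]) (simp add: free_mult_linear cy_linear nf_linear algebra_simps)
next
  case (2 w)
  show ?case
  proof (induction w arbitrary: u)
    case Nil
    show ?case by (rule exI[of _ 0]) (simp add: nf_of)
  next
    case (Cons a w)
    obtain G where G: "cy (u \<star> frag_of [a] \<star> (frag_of w - nf n (frag_of w))) = cy (G \<star> r_elem n)"
      using Cons by blast
    have w: "frag_of (a # w) = frag_of [a] \<star> frag_of w" by simp
    show ?case
    proof (cases "a = Xvar 1")
      case False
      then have "u \<star> (frag_of (a # w) - nf n (frag_of (a # w))) =
          u \<star> frag_of [a] \<star> (frag_of w - nf n (frag_of w))"
        unfolding w nf_letter by (simp add: lmul_def free_mult_linear free_mult_assoc)
      then show ?thesis using G by auto
    next
      case True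
      obtain H where H: "cy (u \<star> (frag_of [Xvar 1] \<star> nf n (frag_of w) - frag_extend (xmul n) (nf n (frag_of w)))) = cy (H \<star> r_elem n)"
        using xmul_mod_r[OF assms] by blast
      from True have "u \<star> (frag_of (a # w) - nf n (frag_of (a # w))) =
          u \<star> frag_of [a] \<star> (frag_of w - nf n (frag_of w)) +
          u \<star> (frag_of [Xvar 1] \<star> nf n (frag_of w) - frag_extend (xmul n) (nf n (frag_of w)))"
        unfolding w nf_letter by (simp add: lmul_def free_mult_linear free_mult_assoc)
      then show ?thesis
        using G H by (intro exI[of _ "G + H"]) (simp add: cy_linear free_mult_linear)
    qed
  qed
qed

section \<open>Reduction of cyclic words and saturation of the image of \<phi>\<close>

section \<open>Cyclic reduction\<close>

text \<open>
  A cyclic word with a letter other than \<open>x\<^sub>1, y\<^sub>1\<close> is reduced after cutting it in front of such a letter.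
  No rewriting takes place across such a cut, so the choice of the cut is irrelevant.
\<close>

definition redw :: "nat \<Rightarrow> letter list \<Rightarrow> letter list set \<Rightarrow>\<^sub>0 int" where
  "redw n w = (if \<exists>w'\<in>rot_class w. w' \<noteq> [] \<and> hd w' \<notin> xy
     then cy (nfw n (SOME w'. w' \<in> rot_class w \<and> w' \<noteq> [] \<and> hd w' \<notin> xy)) else 0)"

definition Red :: "nat \<Rightarrow> (letter list \<Rightarrow>\<^sub>0 int) \<Rightarrow> letter list set \<Rightarrow>\<^sub>0 int" where
  "Red n = frag_extend (redw n)"

lemma rot_inv_redw: "rot_inv (redw n)"
  unfolding redw_def by (rule rot_inv_rot_class_fun)

lemma Red_add: "Red n (f + g) = Red n f + Red n g"
  and Red_diff: "Red n (f - g) = Red n f - Red n g"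
  and Red_minus: "Red n (- f) = - Red n f"
  and Red_cmul: "Red n (frag_cmul k f) = frag_cmul k (Red n f)"
  and Red_0 [simp]: "Red n 0 = 0"
  and Red_of: "Red n (frag_of w) = redw n w"
  by (simp_all add: Red_def frag_extend_linear)

lemmas Red_linear = Red_add Red_diff Red_minus Red_cmul

lemma Red_sum: "Red n (sum F I) = (\<Sum>i\<in>I. Red n (F i))"
  by (simp add: Red_def frag_extend_sum')

lemma Red_commute: "Red n (f \<star> g) = Red n (g \<star> f)"
  unfolding Red_def by (rule frag_extend_rot_inv_commute[OF rot_inv_redw])

lemma Red_cong: "cy f = cy g \<Longrightarrow> Red n f = Red n g"
  unfolding Red_def by (rule frag_extend_rot_inv_cong[OF rot_inv_redw])

lemma Red_fdvd: "fdvd N (cy f) \<Longrightarrow> fdvd N (Red n f)"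
  unfolding Red_def by (rule fdvd_rot_inv[OF rot_inv_redw])

lemma nfw_append_cut:
  assumes "v \<noteq> []" "hd v \<notin> xy"
  shows "nfw n (u @ v) = nfw n u \<star> nfw n v"
proof -
  from assms obtain o' w where v: "v = o' # w" "o' \<notin> xy" by (cases v) auto
  have "nf n (frag_of u \<star> (frag_of [o'] \<star> frag_of w)) = nf n (frag_of u) \<star> (frag_of [o'] \<star> nf n (frag_of w))"
    by (rule nf_split[OF v(2)])
  moreover have "frag_of [o'] \<star> nf n (frag_of w) = nfw n v"
    using v by (simp add: nf_of lmul_def xy_def)
  ultimately show ?thesis by (simp add: nf_of v(1) del: nfw.simps)
qed

text \<open>Two cuts write the cyclic word as u v and v u, both parts starting outside
  \<open>xy\<close>; \<open>nfw\<close> is multiplicative there, and \<open>cy\<close> identifies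
  the two products.\<close>

lemma redw_cut:
  assumes "w \<noteq> []" "hd w \<notin> xy"
  shows "redw n w = cy (nfw n w)"
proof -
  define w' where "w' = (SOME w'. w' \<in> rot_class w \<and> w' \<noteq> [] \<and> hd w' \<notin> xy)"
  have w': "w' \<in> rot_class w \<and> w' \<noteq> [] \<and> hd w' \<notin> xy"
    unfolding w'_def by (rule someI[of _ w]) (use assms in auto)
  then obtain u v where uv: "w = u @ v" "w' = v @ u" by (auto simp: mem_rot_class_iff)
  have "cy (nfw n w') = cy (nfw n w)"
  proof (cases "u = [] \<or> v = []")
    case False
    then have "nfw n w = nfw n u \<star> nfw n v" "nfw n w' = nfw n v \<star> nfw n u"
      using uv w' assms by (auto simp: nfw_append_cut)
    then show ?thesis by (metis cy_mult_commute)
  qed (use uv in auto)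
  moreover have "redw n w = cy (nfw n w')"
    unfolding redw_def w'_def[symmetric] using w' by auto
  ultimately show ?thesis by simp
qed

lemma redw_eq_0: "set w \<subseteq> xy \<Longrightarrow> redw n w = 0"
  unfolding redw_def using set_rot_class hd_in_set by (smt (verit) subsetD)

lemma Red_cut: "o' \<notin> xy \<Longrightarrow> Red n (frag_of [o'] \<star> f) = cy (nf n (frag_of [o'] \<star> f))"
  by (induction f rule: frag_induct)
    (simp_all add: free_mult_linear Red_linear nf_linear cy_linear Red_of nf_of redw_cut del: nfw.simps)

lemma Red_eq_0: "restr xy f = f \<Longrightarrow> Red n f = 0"
  using keys_restr[of xy f] unfolding Red_def
  by (intro frag_extend_eq_0 redw_eq_0) auto

lemma not_subset_xyE:
  assumes "\<not> set w \<subseteq> xy"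
  obtains u o' v where "w = u @ o' # v" "o' \<notin> xy"
  using assms by (metis split_list subsetI)

text \<open>A letter outside \<open>xy\<close> is rotated to the front and the word is cut there; r
  then sits inside a linear word, where \<open>nf_r\<close> annihilates it.\<close>

lemma Red_r_eq_0:
  assumes "n \<ge> 1" "restr xy G = 0"
  shows "Red n (G \<star> r_elem n) = 0"
  using keys_compl_if_restr_0[OF assms(2)]
proof (induction rule: frag_induction)
  case (one w)
  then have "\<not> set w \<subseteq> xy" by simp
  then obtain u o' v where w: "w = u @ o' # v" "o' \<notin> xy" by (rule not_subset_xyE)
  have "Red n (frag_of w \<star> r_elem n) = Red n (frag_of u \<star> (frag_of [o'] \<star> (frag_of v \<star> r_elem n)))"
    by (simp add: w)
  also have "\<dots> = Red n (frag_of [o'] \<star> (frag_of v \<star> (r_elem n \<star> frag_of u)))"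
    by (subst Red_commute) (simp only: free_mult_assoc)
  also have "\<dots> = 0"
    unfolding Red_cut[OF w(2)] using nf_r[OF assms(1), of "frag_of [o'] \<star> frag_of v"]
    by (simp only: free_mult_assoc cy_0)
  finally show ?case .
qed (simp_all add: free_mult_linear Red_linear)

lemma Red_mod_r:
  assumes "n \<ge> 1"
  shows "\<exists>G. cy z - Red n z - cy (restr xy z) = cy (G \<star> r_elem n)"
proof (induction z rule: frag_induct)
  case 1
  show ?case by (rule exI[of _ 0]) simp
next
  case (3 a b)
  then obtain G H where "cy a - Red n a - cy (restr xy a) = cy (G \<star> r_elem n)"
    "cy b - Red n b - cy (restr xy b) = cy (H \<star> r_elem n)" by blast
  then show ?case
    by (intro exI[of _ "G - H"]) (simp add: free_mult_linear cy_linear Red_linear restr_linear algebra_simps)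
next
  case (2 w)
  show ?case
  proof (cases "set w \<subseteq> xy")
    case True
    then show ?thesis by (intro exI[of _ 0]) (simp add: Red_of redw_eq_0 restr_of)
  next
    case False
    then obtain u o' v where w: "w = u @ o' # v" "o' \<notin> xy" by (rule not_subset_xyE)
    let ?w = "o' # v @ u"
    obtain G where G: "cy (frag_of [] \<star> (frag_of ?w - nf n (frag_of ?w))) = cy (G \<star> r_elem n)"
      using nf_mod_r[OF assms] by blast
    have c: "cy (frag_of w) = cy (frag_of ?w)" using rot_class_append[of u "o' # v"] by (simp add: w(1))
    have "Red n (frag_of w) = Red n (frag_of ?w)" by (rule Red_cong[OF c])
    also have "\<dots> = cy (nf n (frag_of ?w))" using w(2) by (simp add: Red_of nf_of redw_cut del: nfw.simps)
    finally show ?thesis using G c False by (intro exI[of _ G]) (simp add: restr_of cy_linear)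
  qed
qed

text \<open>Both \<open>Red\<close> and the restriction to \<open>xy\<close> kill \<phi>(G), hence N
  times their values at z; as there is no torsion, they kill z too. By \<open>Red_mod_r\<close> the
  class of z then lies in the image of \<phi>.\<close>

lemma cy_r_saturated:
  assumes "n \<ge> 1" "restr xy G = 0" "N \<noteq> 0" "fdvd N (cy (G \<star> r_elem n))"
  obtains G' where "cy (G \<star> r_elem n) = frag_cmul N (cy (G' \<star> r_elem n))"
proof -
  obtain z where z: "cy (G \<star> r_elem n) = frag_cmul N (cy z)"
    using fdvd_cy_lift[OF assms(4)] by blast
  then have z': "cy (G \<star> r_elem n) = cy (frag_cmul N z)" by (simp add: cy_linear)
  obtain G' where G': "cy z - Red n z - cy (restr xy z) = cy (G' \<star> r_elem n)"
    using Red_mod_r[OF assms(1)] by blast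
  have "frag_cmul N (Red n z) = 0"
    using Red_cong[OF z', of n] Red_r_eq_0[OF assms(1,2)] by (simp add: Red_linear)
  moreover have "frag_cmul N (cy (restr xy z)) = 0"
    using restr_cy_cong[OF z', of xy] assms(2) by (simp add: restr_mult restr_linear cy_linear)
  ultimately have "cy z = cy (G' \<star> r_elem n)" using G' assms(3) by simp
  then show ?thesis using that z by simp
qed

section \<open>Alternating products of words with a fixed element\<close>

section \<open>Products along a tuple of words\<close>

fun pt :: "('a list \<Rightarrow>\<^sub>0 int) \<Rightarrow> 'a list list \<Rightarrow> 'a list \<Rightarrow>\<^sub>0 int" where
  "pt u [] = frag_of []"
| "pt u (b # bs) = frag_of b \<star> (u \<star> pt u bs)"

text \<open>The product b_1 u b_2 u ... u b_m has one factor u fewer than \<open>pt\<close>. For u =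
  r the map \<phi> supplies the missing factor and makes the value invariant under rotation of the
  tuple.\<close>

fun evt :: "('a list \<Rightarrow>\<^sub>0 int) \<Rightarrow> 'a list list \<Rightarrow> 'a list \<Rightarrow>\<^sub>0 int" where
  "evt u [] = 0"
| "evt u [b] = frag_of b"
| "evt u (b # b' # bs) = frag_of b \<star> (u \<star> evt u (b' # bs))"

lemma pt_append: "pt u (bs @ cs) = pt u bs \<star> pt u cs"
  by (induction bs) (simp_all add: free_mult_assoc)

lemma evt_mult: "bs \<noteq> [] \<Longrightarrow> evt u bs \<star> u = pt u bs"
  by (induction u bs rule: evt.induct) (simp_all add: free_mult_assoc)

lemma evt_snoc: "evt u (bs @ [b]) = pt u bs \<star> frag_of b"
proof (induction bs)
  case (Cons a bs)
  then show ?case by (cases bs) (simp_all add: free_mult_assoc)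
qed simp

lemma rot_inv_pt: "rot_inv (\<lambda>bs. cy (pt u bs))"
  by (rule rot_invI) (simp add: pt_append cy_mult_commute)

lemma rot_inv_evt: "rot_inv (\<lambda>bs. cy (evt u bs \<star> u))"
proof (rule rot_invI)
  fix bs cs :: "'a list list"
  show "cy (evt u (bs @ cs) \<star> u) = cy (evt u (cs @ bs) \<star> u)"
    using evt_mult[of "bs @ cs" u] evt_mult[of "cs @ bs" u]
    by (cases "bs = [] \<and> cs = []") (auto simp: pt_append intro: cy_mult_commute)
qed

lemma restr_evt: "\<forall>b\<in>set bs. set b \<subseteq> S \<Longrightarrow> restr S (evt u bs) = evt (restr S u) bs"
  by (induction u bs rule: evt.induct) (simp_all add: restr_of restr_mult)

text \<open>The last r_1 is replaced by r - c. The term with r rotates to one ending in r whose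
  cofactor contains \<open>t\<close>, so it dies under \<open>Red\<close>. The general
  \<open>t\<close> absorbs the factors already exchanged.\<close>

lemma Red_pt_swap:
  assumes "n \<ge> 1" "restr xy t = 0"
  shows "Red n (pt (rpart 1) bs \<star> t) = Red n (pt (- rtail n) bs \<star> t)"
  using assms(2)
proof (induction bs arbitrary: t rule: rev_induct)
  case (snoc b bs)
  have r1: "rpart 1 = r_elem n + (- rtail n)" using assms(1) by (simp add: r_elem_split)
  let ?t = "frag_of b \<star> (- rtail n \<star> t)"
  let ?G = "t \<star> (pt (rpart 1) bs \<star> frag_of b)"
  have eq: "pt u (bs @ [b]) \<star> t = pt u bs \<star> (frag_of b \<star> (u \<star> t))" for u
    by (simp add: pt_append free_mult_assoc)
  have "Red n (pt (rpart 1) bs \<star> (frag_of b \<star> (r_elem n \<star> t))) = Red n (?G \<star> r_elem n)"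
    using Red_commute[of n "pt (rpart 1) bs \<star> (frag_of b \<star> r_elem n)" t]
    by (simp only: free_mult_assoc)
  also have "\<dots> = 0"
    by (rule Red_r_eq_0[OF assms(1)]) (simp add: restr_mult snoc.prems)
  finally have 0: "Red n (pt (rpart 1) bs \<star> (frag_of b \<star> (r_elem n \<star> t))) = 0" .
  have "Red n (pt (rpart 1) (bs @ [b]) \<star> t) =
      Red n (pt (rpart 1) bs \<star> (frag_of b \<star> ((r_elem n + (- rtail n)) \<star> t)))"
    unfolding eq by (simp only: r1[symmetric])
  also have "\<dots> = Red n (pt (rpart 1) bs \<star> ?t)"
    by (simp only: free_mult_add_left free_mult_add_right Red_add 0 add_0_left)
  also have "\<dots> = Red n (pt (- rtail n) bs \<star> ?t)"
    by (rule snoc.IH) (simp add: restr_mult snoc.prems)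
  finally show ?case unfolding eq .
qed simp

text \<open>In r = r_1 + c the first summand gives words over \<open>xy\<close>, where
  \<open>Red\<close> vanishes; the second gives a factor c, after which \<open>Red_pt_swap\<close>
  exchanges all the others.\<close>

lemma Red_evt_r:
  assumes "n \<ge> 1" "bs \<noteq> []" "\<forall>b\<in>set bs. set b \<subseteq> xy"
  shows "Red n (evt (rpart 1) bs \<star> r_elem n) = - Red n (pt (- rtail n) bs)"
proof -
  obtain bs' b where bs: "bs = bs' @ [b]" using assms(2) by (metis rev_exhaust)
  have "Red n (evt (rpart 1) bs \<star> rpart 1) = 0"
    by (rule Red_eq_0) (use assms in \<open>simp add: restr_mult restr_evt restr_xy_rpart\<close>)
  moreover have "Red n (evt (rpart 1) bs \<star> (- rtail n)) = Red n (pt (- rtail n) bs)"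
  proof -
    have "Red n (evt (rpart 1) bs \<star> (- rtail n)) = Red n (pt (rpart 1) bs' \<star> (frag_of b \<star> (- rtail n)))"
      by (simp add: bs evt_snoc free_mult_assoc)
    also have "\<dots> = Red n (pt (- rtail n) bs' \<star> (frag_of b \<star> (- rtail n)))"
      by (rule Red_pt_swap[OF assms(1)]) (simp add: restr_mult restr_linear restr_xy_rtail)
    also have "\<dots> = Red n (pt (- rtail n) bs)" by (simp add: bs pt_append)
    finally show ?thesis .
  qed
  moreover have "evt (rpart 1) bs \<star> r_elem n = evt (rpart 1) bs \<star> rpart 1 - evt (rpart 1) bs \<star> (- rtail n)"
    using assms(1) by (simp add: r_elem_split free_mult_linear free_mult_minus_right)
  ultimately show ?thesis by (simp add: Red_diff)
qed

section \<open>Spanning the words in x_1, y_1 by products of normal words with r_1\<close>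

section \<open>Normal words in \<open>x\<^sub>1, y\<^sub>1\<close>\<close>

definition nwords :: "letter list set" where
  "nwords = {replicate i (Yvar 1) @ replicate j (Xvar 1) |i j. True}"

lemma nwordsI: "replicate i (Yvar 1) @ replicate j (Xvar 1) \<in> nwords"
  by (auto simp: nwords_def)

lemma nwords_xy: "b \<in> nwords \<Longrightarrow> set b \<subseteq> xy"
  by (auto simp: nwords_def xy_def)

lemma Nil_nwords [simp]: "[] \<in> nwords"
  by (auto simp: nwords_def)

lemma nfw_nwords:
  assumes "b \<in> nwords"
  shows "nfw n b = frag_of b"
proof -
  have X: "nfw n (replicate j (Xvar 1)) = frag_of (replicate j (Xvar 1))" for j
  proof (induction j)
    case (Suc j)
    then show ?case by (cases j) (simp_all add: lmul_def)
  qed simp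
  have "nfw n (replicate i (Yvar 1) @ replicate j (Xvar 1)) =
    frag_of (replicate i (Yvar 1) @ replicate j (Xvar 1))" for i j
    using X[of j] by (induction i) (simp_all add: lmul_def)
  then show ?thesis using assms by (auto simp: nwords_def)
qed

text \<open>Every monomial of c begins and ends with a letter outside \<open>xy\<close>, so
  \<open>nf_split\<close> cuts on both sides of it.\<close>

lemma nf_cut_rtail:
  "nf n (f \<star> (- rtail m \<star> g)) = nf n f \<star> (- rtail m \<star> nf n g)"
proof -
  have "nf n (f \<star> (frag_of [a, b] \<star> g)) = nf n f \<star> (frag_of [a, b] \<star> nf n g)"
    if "a \<notin> xy" "b \<notin> xy" for a b
  proof -
    have "frag_of [a, b] \<star> g = frag_of [a] \<star> (frag_of [] \<star> (frag_of [b] \<star> g))" for g by simp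
    then show ?thesis
      using nf_split[OF that(1), of n f "frag_of [] \<star> (frag_of [b] \<star> g)"] nf_split[OF that(2), of n "frag_of []" g]
      by (simp add: nf_of)
  qed
  then have "nf n (f \<star> (rpart i \<star> g)) = nf n f \<star> (rpart i \<star> nf n g)" if "i \<noteq> 1" for i
    using that by (simp add: rpart_def free_mult_linear nf_linear xy_def)
  then have "nf n (f \<star> (rtail m \<star> g)) = nf n f \<star> (rtail m \<star> nf n g)"
    by (simp add: rtail_def free_mult_sum_left free_mult_sum_right nf_sum)
  then show ?thesis by (simp add: free_mult_minus_left free_mult_minus_right nf_linear)
qed

lemma Red_rtail_left: "Red n (- rtail m \<star> f) = cy (nf n (- rtail m \<star> f))"
proof -
  have "Red n (frag_of [a, b] \<star> f) = cy (nf n (frag_of [a, b] \<star> f))" if "a \<notin> xy" for a b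
    using Red_cut[OF that, of n "frag_of [b] \<star> f"] by simp
  then have "Red n (rpart i \<star> f) = cy (nf n (rpart i \<star> f))" if "i \<noteq> 1" for i
    using that by (simp add: rpart_def free_mult_linear nf_linear cy_linear Red_linear xy_def)
  then show ?thesis
    by (simp add: rtail_def free_mult_sum_left free_mult_minus_left nf_linear cy_linear Red_linear
        Red_sum nf_sum cy_sum)
qed

lemma nf_evt: "set bs \<subseteq> nwords \<Longrightarrow> nf n (evt (- rtail m) bs) = evt (- rtail m) bs"
  by (induction bs rule: evt.induct[of _ undefined])
    (simp_all add: nf_of nfw_nwords nf_cut_rtail)

text \<open>Rotated to start with c, the product is cut at every c into words that are already
  normal.\<close>

lemma Red_pt_rtail:
  assumes "bs \<noteq> []" "set bs \<subseteq> nwords"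
  shows "Red n (pt (- rtail m) bs) = cy (pt (- rtail m) bs)"
proof -
  let ?c = "- rtail m"
  have "Red n (pt ?c bs) = Red n (?c \<star> evt ?c bs)"
    using assms(1) by (metis Red_commute evt_mult)
  also have "\<dots> = cy (?c \<star> evt ?c bs)"
    using nf_cut_rtail[of n "frag_of []" m "evt ?c bs"]
    by (simp add: Red_rtail_left nf_evt[OF assms(2)] nf_of)
  also have "\<dots> = cy (pt ?c bs)"
    using assms(1) by (metis cy_mult_commute evt_mult)
  finally show ?thesis .
qed

definition ntuples :: "letter list list set" where
  "ntuples = {bs. bs \<noteq> [] \<and> set bs \<subseteq> nwords}"

lemma evt_letter: "frag_of [a] \<star> evt u (b # bs) = evt u ((a # b) # bs)"
  by (cases bs) simp_all

text \<open>Since x_1 y_1 = y_1 x_1 + r_1, moving x_1 to the right through the first entry only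
  creates new factors r_1. So the span of these products is closed under left multiplication by both
  letters.\<close>

lemma evt_span:
  assumes "Poly_Mapping.keys f \<subseteq> lists xy"
  obtains \<tau> where "Poly_Mapping.keys \<tau> \<subseteq> ntuples" "f = frag_extend (evt (rpart 1)) \<tau>"
proof -
  define E where "E = (\<lambda>f. \<exists>\<tau>. Poly_Mapping.keys \<tau> \<subseteq> ntuples \<and> f = frag_extend (evt (rpart 1)) \<tau>)"
  have E0: "E 0" unfolding E_def by (rule exI[of _ 0]) simp
  have E1: "E (evt (rpart 1) bs)" if "bs \<in> ntuples" for bs
    unfolding E_def by (rule exI[of _ "frag_of bs"]) (use that in simp)
  have Ed: "E (f - g)" if "E f" "E g" for f g
  proof -
    from that obtain \<sigma> \<tau> where "Poly_Mapping.keys \<sigma> \<subseteq> ntuples" "f = frag_extend (evt (rpart 1)) \<sigma>"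
      "Poly_Mapping.keys \<tau> \<subseteq> ntuples" "g = frag_extend (evt (rpart 1)) \<tau>" unfolding E_def by blast
    then show ?thesis unfolding E_def
      using keys_diff[of \<sigma> \<tau>] by (intro exI[of _ "\<sigma> - \<tau>"]) (auto simp: frag_extend_diff)
  qed
  have Ea: "E (f + g)" if "E f" "E g" for f g
    using Ed[OF that(1) Ed[OF E0 that(2)]] by simp
  have Emul: "E (frag_of [a] \<star> f)" if "E f" "\<And>bs. bs \<in> ntuples \<Longrightarrow> E (frag_of [a] \<star> evt (rpart 1) bs)" for a f
  proof -
    from that(1) obtain \<tau> where \<tau>: "Poly_Mapping.keys \<tau> \<subseteq> ntuples" "f = frag_extend (evt (rpart 1)) \<tau>"
      unfolding E_def by blast
    from \<tau>(1) have "E (frag_of [a] \<star> frag_extend (evt (rpart 1)) \<tau>)"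
    proof (induction rule: frag_induction)
      case (one bs)
      then show ?case unfolding frag_extend_of by (rule that(2))
    qed (simp_all add: E0 Ed frag_extend_diff free_mult_linear)
    then show ?thesis by (simp add: \<tau>(2))
  qed
  have EY: "E (frag_of [Yvar 1] \<star> f)" if "E f" for f
  proof (rule Emul[OF that])
    fix bs assume "bs \<in> ntuples"
    then obtain i j bs' where bs: "bs = (replicate i (Yvar 1) @ replicate j (Xvar 1)) # bs'" "set bs' \<subseteq> nwords"
      unfolding ntuples_def by (cases bs) (auto simp: nwords_def)
    have "(replicate (Suc i) (Yvar 1) @ replicate j (Xvar 1)) # bs' \<in> ntuples"
      using bs nwordsI[of "Suc i" j] by (auto simp: ntuples_def simp del: replicate.simps)
    then show "E (frag_of [Yvar 1] \<star> evt (rpart 1) bs)"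
      using E1 by (simp add: bs evt_letter)
  qed
  have EX: "E (frag_of [Xvar 1] \<star> f)" if "E f" for f
  proof (rule Emul[OF that])
    fix bs assume "bs \<in> ntuples"
    then obtain i j bs' where bs: "bs = (replicate i (Yvar 1) @ replicate j (Xvar 1)) # bs'" "set bs' \<subseteq> nwords"
      unfolding ntuples_def by (cases bs) (auto simp: nwords_def)
    have "E (frag_of [Xvar 1] \<star> evt (rpart 1) ((replicate i (Yvar 1) @ replicate j (Xvar 1)) # bs'))"
    proof (induction i)
      case 0
      have "(replicate 0 (Yvar 1) @ replicate (Suc j) (Xvar 1)) # bs' \<in> ntuples"
        using bs nwordsI[of 0 "Suc j"] by (auto simp: ntuples_def simp del: replicate.simps)
      then show ?case using E1 by (simp add: evt_letter)
    next
      case (Suc i)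
      let ?b = "replicate i (Yvar 1) @ replicate j (Xvar 1)"
      \<comment> \<open>The empty entry in front produces the new leading factor r_1.\<close>
      have "[] # ?b # bs' \<in> ntuples"
        using bs nwordsI[of i j] by (auto simp: ntuples_def)
      from E1[OF this] have "E (rpart 1 \<star> evt (rpart 1) (?b # bs'))" by simp
      moreover have "frag_of [Xvar 1] \<star> evt (rpart 1) ((Yvar 1 # ?b) # bs') =
          frag_of [Yvar 1] \<star> (frag_of [Xvar 1] \<star> evt (rpart 1) (?b # bs')) + rpart 1 \<star> evt (rpart 1) (?b # bs')"
        unfolding evt_letter[symmetric] by (simp add: rpart_def free_mult_linear)
      ultimately show ?case using Ea[OF EY[OF Suc]] by simp
    qed
    then show "E (frag_of [Xvar 1] \<star> evt (rpart 1) bs)" by (simp add: bs)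
  qed
  have "E (frag_of w)" if "set w \<subseteq> xy" for w
    using that
  proof (induction w)
    case Nil
    then show ?case using E1[of "[[]]"] by (simp add: ntuples_def)
  next
    case (Cons a w)
    then have "a = Xvar 1 \<or> a = Yvar 1" "E (frag_of w)" by (auto simp: xy_def)
    then have "E (frag_of [a] \<star> frag_of w)" using EX EY by blast
    then show ?case by simp
  qed
  with assms have "E f" by (induction rule: frag_induction) (auto simp: E0 Ed)
  then show ?thesis using that unfolding E_def by blast
qed

section \<open>A linear functional detecting tuples up to rotation\<close>

section \<open>Reading off a tuple from a cyclic word\<close>

text \<open>The monomial of b_1 c b_2 c ... b_m c that takes x_2 y_2 from every c; it serves to
  identify the tuple.\<close>

definition J :: "letter list list \<Rightarrow> letter list" where
  "J bs = concat (map (\<lambda>b. b @ [Xvar 2, Yvar 2]) bs)"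

definition xy_tuple :: "letter list list \<Rightarrow> bool" where
  "xy_tuple bs \<longleftrightarrow> (\<forall>b\<in>set bs. set b \<subseteq> xy)"

definition nonconst :: "'a list list \<Rightarrow> bool" where
  "nonconst bs \<longleftrightarrow> (\<exists>b\<in>set bs. b \<noteq> [])"

lemma J_simps [simp]: "J [] = []" "J (b # bs) = b @ Xvar 2 # Yvar 2 # J bs" "J (bs @ cs) = J bs @ J cs"
  by (simp_all add: J_def)

lemma xy_tuple_simps [simp]:
  "xy_tuple []" "xy_tuple (b # bs) \<longleftrightarrow> set b \<subseteq> xy \<and> xy_tuple bs"
  "xy_tuple (bs @ cs) \<longleftrightarrow> xy_tuple bs \<and> xy_tuple cs"
  by (auto simp: xy_tuple_def)

lemma letter2_notin_xy [simp]: "Xvar 2 \<notin> xy" "Yvar 2 \<notin> xy"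
  by (auto simp: xy_def)

lemma append_Cons_unique:
  "x \<notin> set xs \<Longrightarrow> x \<notin> set xs' \<Longrightarrow> xs @ x # ys = xs' @ x # ys' \<Longrightarrow> xs = xs' \<and> ys = ys'"
proof (induction xs arbitrary: xs')
  case Nil
  then show ?case by (cases xs') auto
next
  case (Cons a xs)
  then show ?case by (cases xs') auto
qed

lemma J_inj: "xy_tuple bs \<Longrightarrow> xy_tuple bs' \<Longrightarrow> J bs = J bs' \<Longrightarrow> bs = bs'"
proof (induction bs arbitrary: bs')
  case Nil
  then show ?case by (cases bs') auto
next
  case (Cons b bs)
  then obtain b' cs where bs': "bs' = b' # cs" by (cases bs') auto
  with Cons.prems have "Xvar 2 \<notin> set b" "Xvar 2 \<notin> set b'"
    using letter2_notin_xy by auto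
  from append_Cons_unique[OF this] Cons.prems bs' have "b = b'" "J bs = J cs" by auto
  then show ?case using Cons bs' by auto
qed

text \<open>In \<open>J bs\<close> the letter y_2 occurs only at the end of a block, so a cut behind
  it falls between two entries.\<close>

lemma J_cut:
  "xy_tuple bs \<Longrightarrow> J bs = u @ v \<Longrightarrow> u = [] \<or> last u = Yvar 2 \<Longrightarrow>
    \<exists>cs ds. bs = cs @ ds \<and> u = J cs \<and> v = J ds"
proof (induction bs arbitrary: u)
  case Nil
  then show ?case by simp
next
  case (Cons b bs)
  show ?case
  proof (cases "u = []")
    case True
    then show ?thesis using Cons.prems by (intro exI[of _ "[]"] exI[of _ "b # bs"]) simp
  next
    case False
    then obtain u' where u': "u = u' @ [Yvar 2]"
      using Cons.prems(3) by (metis append_butlast_last_id)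
    have b: "Yvar 2 \<notin> set (b @ [Xvar 2])" using Cons.prems(1) letter2_notin_xy by auto
    have eq: "(b @ [Xvar 2]) @ Yvar 2 # J bs = u' @ Yvar 2 # v" using Cons.prems(2) u' by simp
    show ?thesis
    proof (cases "Yvar 2 \<in> set u'")
      case False
      from append_Cons_unique[OF b False eq] show ?thesis
        using u' by (intro exI[of _ "[b]"] exI[of _ bs]) simp
    next
      case True
      then obtain u1 u2 where u1: "u' = u1 @ Yvar 2 # u2" "Yvar 2 \<notin> set u1" by (metis split_list_first)
      with eq have "(b @ [Xvar 2]) @ Yvar 2 # J bs = u1 @ Yvar 2 # (u2 @ Yvar 2 # v)" by simp
      from append_Cons_unique[OF b u1(2) this] have *: "u1 = b @ [Xvar 2]" "J bs = (u2 @ [Yvar 2]) @ v" by simp_all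
      with Cons.IH[of "u2 @ [Yvar 2]"] Cons.prems(1)
      obtain cs ds where "bs = cs @ ds" "u2 @ [Yvar 2] = J cs" "v = J ds" by auto
      then show ?thesis using u' u1 * by (intro exI[of _ "b # cs"] exI[of _ ds]) simp
    qed
  qed
qed

lemma J_eq_Nil [simp]: "J bs = [] \<longleftrightarrow> bs = []"
  by (cases bs) auto

lemma set_J: "xy_tuple bs \<Longrightarrow> set (J bs) \<subseteq> xy \<union> {Xvar 2, Yvar 2}"
  by (induction bs) auto

lemma set_subset_set_J: "b \<in> set bs \<Longrightarrow> set b \<subseteq> set (J bs)"
  by (induction bs) auto

lemma last_J: "bs \<noteq> [] \<Longrightarrow> last (J bs) = Yvar 2"
  by (induction bs) auto

text \<open>As \<open>J bs'\<close> ends in y_2, the rotation cuts \<open>J bs\<close> between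
  blocks and is therefore a rotation of tuples.\<close>

lemma J_rot_class:
  assumes "xy_tuple bs" "xy_tuple bs'" "J bs' \<in> rot_class (J bs)"
  shows "rot_class bs' = rot_class bs"
proof -
  from assms(3) obtain u v where uv: "J bs = u @ v" "J bs' = v @ u" by (auto simp: mem_rot_class_iff)
  have "u = [] \<or> last u = Yvar 2"
    using last_J[of bs'] uv(2) by (cases "u = []"; cases "bs' = []") auto
  from J_cut[OF assms(1) uv(1) this] obtain cs ds where cd: "bs = cs @ ds" "u = J cs" "v = J ds" by blast
  then have "J bs' = J (ds @ cs)" by (simp add: uv)
  then have "bs' = ds @ cs" using assms(1,2) cd(1) by (intro J_inj) auto
  then show ?thesis by (simp add: cd(1) rot_class_append)
qed

lemma J_follow_linear:
  "xy_tuple bs \<Longrightarrow> J bs = u @ Xvar 2 # v \<Longrightarrow> v \<noteq> [] \<and> hd v = Yvar 2"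
proof (induction bs arbitrary: u)
  case (Cons b bs)
  have b: "Xvar 2 \<notin> set b" using Cons.prems(1) letter2_notin_xy by auto
  have eq: "b @ Xvar 2 # (Yvar 2 # J bs) = u @ Xvar 2 # v" using Cons.prems(2) by simp
  show ?case
  proof (cases "Xvar 2 \<in> set u")
    case False
    from append_Cons_unique[OF b False eq] show ?thesis by auto
  next
    case True
    then obtain u1 u2 where u: "u = u1 @ Xvar 2 # u2" "Xvar 2 \<notin> set u1" by (metis split_list_first)
    with eq have "b @ Xvar 2 # (Yvar 2 # J bs) = u1 @ Xvar 2 # (u2 @ Xvar 2 # v)" by simp
    from append_Cons_unique[OF b u(2) this] have "Yvar 2 # J bs = u2 @ Xvar 2 # v" by simp
    then obtain u3 where "J bs = u3 @ Xvar 2 # v" by (cases u2) auto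
    then show ?thesis using Cons.IH Cons.prems(1) by auto
  qed
qed simp

lemma J_follow:
  assumes "xy_tuple bs" "Xvar 2 # z \<in> rot_class (J bs)"
  shows "z \<noteq> [] \<and> hd z = Yvar 2"
proof -
  from assms(2) obtain u v where uv: "J bs = u @ v" "Xvar 2 # z = v @ u" by (auto simp: mem_rot_class_iff)
  show ?thesis
  proof (cases v)
    case Nil
    then show ?thesis using J_follow_linear[OF assms(1), of "[]" z] uv by simp
  next
    case (Cons a v')
    then show ?thesis using J_follow_linear[OF assms(1), of u v'] uv by auto
  qed
qed

text \<open>
  In the cyclic words \<open>b\<^sub>1 x\<^sub>2 y\<^sub>2 b\<^sub>2 x\<^sub>2 y\<^sub>2 \<dots> b\<^sub>m x\<^sub>2 y\<^sub>2\<close> each \<open>x\<^sub>2\<close> is followed by \<open>y\<^sub>2\<close>. If the \<open>b\<^sub>i\<close> are not all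
  empty, this fails as soon as some of the \<open>x\<^sub>2 y\<^sub>2\<close> are replaced by \<open>y\<^sub>2 x\<^sub>2\<close>. Hence \<open>tuple_of_word\<close>, which
  recognises these words, only sees the term \<open>x\<^sub>2 y\<^sub>2\<close> of \<open>\<Sum>\<^sub>i\<^sub>\<ge>\<^sub>2 [x\<^sub>i, y\<^sub>i]\<close>. Its sign cancels the one in
  the powers of \<open>- rtail n\<close>.
\<close>

definition tuple_of_word :: "letter list \<Rightarrow> letter list list set \<Rightarrow>\<^sub>0 int" where
  "tuple_of_word w = (if \<exists>bs. xy_tuple bs \<and> nonconst bs \<and> J bs \<in> rot_class w
     then (let bs = SOME bs. xy_tuple bs \<and> nonconst bs \<and> J bs \<in> rot_class w
           in frag_cmul ((-1) ^ length bs) (frag_of (rot_class bs))) else 0)"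

lemma rot_inv_tuple_of_word: "rot_inv tuple_of_word"
  unfolding tuple_of_word_def by (rule rot_inv_rot_class_fun)

lemma tuple_of_word_J:
  assumes "xy_tuple bs" "nonconst bs"
  shows "tuple_of_word (J bs) = frag_cmul ((-1) ^ length bs) (frag_of (rot_class bs))"
proof -
  define cs where "cs = (SOME cs. xy_tuple cs \<and> nonconst cs \<and> J cs \<in> rot_class (J bs))"
  have cs: "xy_tuple cs \<and> nonconst cs \<and> J cs \<in> rot_class (J bs)"
    unfolding cs_def by (rule someI[of _ bs]) (use assms in simp)
  then have "rot_class cs = rot_class bs" using J_rot_class assms(1) by blast
  moreover from this have "length cs = length bs" by (metis length_rot_class self_in_rot_class)
  ultimately show ?thesis
    unfolding tuple_of_word_def Let_def cs_def[symmetric] using assms by auto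
qed

lemma tuple_of_word_eq_0_letter: "a \<in> set w \<Longrightarrow> a \<notin> xy \<Longrightarrow> a \<noteq> Xvar 2 \<Longrightarrow> a \<noteq> Yvar 2 \<Longrightarrow> tuple_of_word w = 0"
proof -
  assume a: "a \<in> set w" "a \<notin> xy" "a \<noteq> Xvar 2" "a \<noteq> Yvar 2"
  have "J bs \<notin> rot_class w" if "xy_tuple bs" for bs
  proof
    assume "J bs \<in> rot_class w"
    then have "a \<in> set (J bs)" using a(1) set_rot_class by blast
    then show False using a(2-) set_J[OF that] by auto
  qed
  then show ?thesis by (auto simp: tuple_of_word_def)
qed

lemma tuple_of_word_eq_0_const: "set w \<inter> xy = {} \<Longrightarrow> tuple_of_word w = 0"
proof -
  assume w: "set w \<inter> xy = {}"
  have "J bs \<notin> rot_class w" if bs: "xy_tuple bs" "nonconst bs" for bs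
  proof
    assume "J bs \<in> rot_class w"
    then have "set (J bs) \<inter> xy = {}" using w set_rot_class by blast
    moreover obtain b where "b \<in> set bs" "b \<noteq> []" using bs(2) by (auto simp: nonconst_def)
    ultimately show False
      using bs(1) set_subset_set_J[of b bs] hd_in_set[of b] unfolding xy_tuple_def by blast
  qed
  then show ?thesis by (auto simp: tuple_of_word_def)
qed

lemma tuple_of_word_eq_0_follow:
  assumes "Xvar 2 # z \<in> rot_class w" "z = [] \<or> hd z \<noteq> Yvar 2"
  shows "tuple_of_word w = 0"
proof -
  have "J bs \<notin> rot_class w" if "xy_tuple bs" for bs
    using J_follow[OF that] assms rot_class_eq by metis
  then show ?thesis by (auto simp: tuple_of_word_def)
qed

definition Wext :: "(letter list \<Rightarrow>\<^sub>0 int) \<Rightarrow> letter list list set \<Rightarrow>\<^sub>0 int" where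
  "Wext = frag_extend tuple_of_word"

lemma Wext_add: "Wext (f + g) = Wext f + Wext g"
  and Wext_diff: "Wext (f - g) = Wext f - Wext g"
  and Wext_minus: "Wext (- f) = - Wext f"
  and Wext_cmul: "Wext (frag_cmul k f) = frag_cmul k (Wext f)"
  and Wext_0 [simp]: "Wext 0 = 0"
  and Wext_of: "Wext (frag_of w) = tuple_of_word w"
  by (simp_all add: Wext_def frag_extend_linear)

lemmas Wext_linear = Wext_add Wext_diff Wext_minus Wext_cmul

lemma Wext_sum: "Wext (sum F I) = (\<Sum>i\<in>I. Wext (F i))"
  by (simp add: Wext_def frag_extend_sum')

lemma hd_J_neq: "xy_tuple t \<Longrightarrow> l \<in> xy \<Longrightarrow> hd (J t @ l # u) \<noteq> Yvar 2"
proof (cases t)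
  case (Cons b bs)
  assume "xy_tuple t" "l \<in> xy"
  then show ?thesis using Cons letter2_notin_xy(2) by (cases b) auto
qed auto

text \<open>In the term y_2 x_2 the letter x_2 is followed by the first letter of \<open>J t\<close>
  or, for empty \<open>t\<close>, cyclically by \<open>l\<close>, and never by y_2. Terms with i
  \<ge> 3 contain letters foreign to all words \<open>J bs\<close>.\<close>

lemma Wext_rtail:
  assumes "n \<ge> 2" "l \<in> xy" "xy_tuple t"
  shows "Wext (frag_of [l] \<star> (f \<star> (rtail n \<star> frag_of (J t)))) =
    Wext (frag_of [l] \<star> (f \<star> frag_of (Xvar 2 # Yvar 2 # J t)))"
proof (induction f rule: frag_induct)
  case (2 u)
  have "tuple_of_word (l # u @ Yvar 2 # Xvar 2 # J t) = 0"
  proof (rule tuple_of_word_eq_0_follow)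
    show "Xvar 2 # (J t @ l # u @ [Yvar 2]) \<in> rot_class (l # u @ Yvar 2 # Xvar 2 # J t)"
      using rot_class_append[of "l # u @ [Yvar 2]" "Xvar 2 # J t"] self_in_rot_class
      by (metis append.assoc append_Cons append_Nil)
    show "J t @ l # u @ [Yvar 2] = [] \<or> hd (J t @ l # u @ [Yvar 2]) \<noteq> Yvar 2"
      using hd_J_neq[OF assms(3,2)] by blast
  qed
  then have two: "Wext (frag_of [l] \<star> (frag_of u \<star> (rpart 2 \<star> frag_of (J t)))) =
    tuple_of_word (l # u @ Xvar 2 # Yvar 2 # J t)"
    by (simp add: rpart_def free_mult_linear Wext_linear Wext_of)
  have "Wext (frag_of [l] \<star> (frag_of u \<star> (rpart i \<star> frag_of (J t)))) = 0" if "i \<ge> 3" for i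
    using that
    by (simp add: rpart_def free_mult_linear Wext_linear Wext_of tuple_of_word_eq_0_letter[of "Xvar i"] xy_def)
  moreover have "rtail n = rpart 2 + (\<Sum>i=3..n. rpart i)"
    using assms(1) by (simp add: rtail_def sum.atLeast_Suc_atMost)
  ultimately show ?case
    using two
    by (simp add: free_mult_linear free_mult_sum_left free_mult_sum_right Wext_linear Wext_sum Wext_of)
qed (simp_all add: free_mult_linear Wext_linear)

text \<open>The factors c are resolved from right to left, and the entries before those already
  replaced by x_2 y_2 are collected in \<open>t\<close>.\<close>

lemma Wext_pt_prefix:
  assumes "n \<ge> 2" "l \<in> xy" "xy_tuple (bs @ t)"
  shows "Wext (frag_of [l] \<star> (pt (rtail n) bs \<star> frag_of (J t))) = tuple_of_word (l # J (bs @ t))"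
  using assms(3)
proof (induction bs arbitrary: t rule: rev_induct)
  case Nil
  then show ?case by (simp add: Wext_of)
next
  case (snoc b bs)
  have "Wext (frag_of [l] \<star> (pt (rtail n) (bs @ [b]) \<star> frag_of (J t))) =
      Wext (frag_of [l] \<star> ((pt (rtail n) bs \<star> frag_of b) \<star> (rtail n \<star> frag_of (J t))))"
    by (simp add: pt_append free_mult_assoc)
  also have "\<dots> = Wext (frag_of [l] \<star> ((pt (rtail n) bs \<star> frag_of b) \<star> frag_of (Xvar 2 # Yvar 2 # J t)))"
    by (rule Wext_rtail) (use assms snoc.prems in auto)
  also have "\<dots> = Wext (frag_of [l] \<star> (pt (rtail n) bs \<star> frag_of (J (b # t))))"
    by (simp add: free_mult_assoc)
  also have "\<dots> = tuple_of_word (l # J (bs @ (b # t)))"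
    by (rule snoc.IH) (use snoc.prems in auto)
  finally show ?case by simp
qed

lemma frag_cmul_minus: "frag_cmul k (- f) = - frag_cmul k f"
  by (rule poly_mapping_eqI) simp

lemma pt_minus: "pt (- u) bs = frag_cmul ((-1) ^ length bs) (pt u bs)"
  by (induction bs) (simp_all add: free_mult_minus_left free_mult_minus_right
      free_mult_cmul_left free_mult_cmul_right frag_cmul_minus)

lemma keys_pt_rtail_const:
  assumes "\<not> nonconst bs"
  shows "Poly_Mapping.keys (pt (rtail n) bs) \<subseteq> lists (- xy)"
  using assms
proof (induction bs)
  case (Cons b bs)
  have "Poly_Mapping.keys (rpart i) \<subseteq> lists (- xy)" if "2 \<le> i" for i
    unfolding rpart_def by (rule order_trans[OF keys_diff]) (use that in \<open>auto simp: xy_def\<close>)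
  then have "Poly_Mapping.keys (rtail n) \<subseteq> lists (- xy)"
    unfolding rtail_def by (intro order_trans[OF keys_sum] UN_least) auto
  moreover have "Poly_Mapping.keys (pt (rtail n) bs) \<subseteq> lists (- xy)" "b = []"
    using Cons by (auto simp: nonconst_def)
  ultimately show ?case by (simp add: keys_free_mult)
qed simp

text \<open>A nonempty entry is rotated to the front and its first letter \<open>l\<close> split
  off, as \<open>Wext_pt_prefix\<close> requires. If all entries are empty, the monomials avoid x_1,
  y_1 and are not detected.\<close>

lemma Wext_pt:
  assumes "n \<ge> 2" "xy_tuple bs"
  shows "Wext (pt (- rtail n) bs) = (if nonconst bs then frag_of (rot_class bs) else 0)"
proof (cases "nonconst bs")
  case True
  then obtain cs b ds where "bs = cs @ b # ds" "b \<noteq> []"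
    by (metis nonconst_def split_list)
  then obtain l b' where bs: "bs = cs @ (l # b') # ds" by (metis neq_Nil_conv)
  let ?bs = "(l # b') # ds @ cs"
  have rc: "rot_class bs = rot_class ?bs"
    using rot_class_append[of cs "(l # b') # ds"] by (simp add: bs)
  have ok: "l \<in> xy" "xy_tuple ((b' # ds @ cs) @ [])" "xy_tuple ?bs" using assms(2) by (auto simp: bs)
  have "Wext (pt (rtail n) bs) = Wext (pt (rtail n) ?bs)"
    unfolding Wext_def
    by (rule frag_extend_rot_inv_cong[OF rot_inv_tuple_of_word], rule rot_invD[OF rot_inv_pt]) (metis rc self_in_rot_class)
  also have "\<dots> = Wext (frag_of [l] \<star> (pt (rtail n) (b' # ds @ cs) \<star> frag_of (J [])))"
    by simp
  also have "\<dots> = tuple_of_word (l # J ((b' # ds @ cs) @ []))"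
    by (rule Wext_pt_prefix[OF assms(1) ok(1,2)])
  also have "\<dots> = tuple_of_word (J ?bs)" by simp
  also have "\<dots> = frag_cmul ((-1) ^ length ?bs) (frag_of (rot_class ?bs))"
    by (rule tuple_of_word_J[OF ok(3)]) (simp add: nonconst_def)
  finally have "Wext (pt (rtail n) bs) = frag_cmul ((-1) ^ length bs) (frag_of (rot_class bs))"
    by (simp add: rc) (simp add: bs add.commute)
  then show ?thesis using True by (simp add: pt_minus Wext_linear flip: power_add)
next
  case False
  have "Wext (pt (rtail n) bs) = 0"
    unfolding Wext_def
    by (rule frag_extend_eq_0, rule tuple_of_word_eq_0_const) (use keys_pt_rtail_const[OF False, of n] in auto)
  then show ?thesis using False by (simp add: pt_minus Wext_linear)
qed

definition nonconst_part :: "('a list list \<Rightarrow>\<^sub>0 int) \<Rightarrow> 'a list list \<Rightarrow>\<^sub>0 int" where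
  "nonconst_part = frag_extend (\<lambda>bs. if nonconst bs then frag_of bs else 0)"

lemma ntuples_xy_tuple: "bs \<in> ntuples \<Longrightarrow> xy_tuple bs"
  using nwords_xy by (auto simp: ntuples_def xy_tuple_def)

text \<open>\<open>Red\<close> kills what comes from words of F with other letters and turns the
  rest into products with -c; \<open>Wext\<close> reads off their tuples. Both maps are linear, so
  divisibility survives. In the conclusion \<open>cy\<close> refers to rotation of tuples.\<close>

lemma nonconst_part_fdvd:
  assumes "n \<ge> 2" "Poly_Mapping.keys \<tau> \<subseteq> ntuples" "restr xy F = frag_extend (evt (rpart 1)) \<tau>"
    and "fdvd N (cy (F \<star> r_elem n))"
  shows "fdvd N (cy (nonconst_part \<tau>))"
proof -
  have n: "n \<ge> 1" using assms(1) by simp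
  let ?c = "- rtail n"
  have "Red n (F \<star> r_elem n) = Red n (restr xy F \<star> r_elem n) + Red n ((F - restr xy F) \<star> r_elem n)"
    by (simp add: free_mult_linear Red_linear)
  also have "Red n ((F - restr xy F) \<star> r_elem n) = 0"
    by (rule Red_r_eq_0[OF n]) (simp add: restr_linear)
  also have "Red n (restr xy F \<star> r_elem n) = - cy (frag_extend (pt ?c) \<tau>)"
    unfolding assms(3) using assms(2)
  proof (induction rule: frag_induction)
    case (one bs)
    then show ?case
      using Red_evt_r[OF n, of bs] Red_pt_rtail[of bs n n] nwords_xy by (auto simp: ntuples_def)
  qed (simp_all add: frag_extend_linear free_mult_linear Red_linear cy_linear)
  finally have "fdvd N (- cy (frag_extend (pt ?c) \<tau>))"
    using Red_fdvd[OF assms(4), of n] by simp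
  then have "fdvd N (Wext (frag_extend (pt ?c) \<tau>))"
    unfolding Wext_def fdvd_minus_iff by (rule fdvd_rot_inv[OF rot_inv_tuple_of_word])
  moreover have "Wext (frag_extend (pt ?c) \<tau>) = cy (nonconst_part \<tau>)"
    using assms(2)
  proof (induction rule: frag_induction)
    case (one bs)
    then show ?case using Wext_pt[OF assms(1) ntuples_xy_tuple, of bs] by (simp add: nonconst_part_def)
  qed (simp_all add: frag_extend_linear Wext_linear cy_linear nonconst_part_def)
  ultimately show ?thesis by simp
qed

section \<open>Orbit counting and the divisibility of \<pi>(r^(p^l)) by p\<close>

section \<open>Powers and rotation classes\<close>

lemma rotate_inj: "rotate k xs = rotate k ys \<Longrightarrow> xs = ys"
  using inj_fn[OF inj_rotate1, of k] by (auto simp: rotate_def inj_def)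

text \<open>The size of the orbit is the least period d, and division with remainder shows that d
  divides every other period.\<close>

lemma card_rot_class_dvd:
  assumes "q > 0" "rotate q w = w"
  shows "card (rot_class w) dvd q"
proof -
  define d where "d = (LEAST d. d > 0 \<and> rotate d w = w)"
  have d: "d > 0 \<and> rotate d w = w"
    unfolding d_def by (rule LeastI[of _ q]) (use assms in simp)
  have least: "d \<le> e" if "e > 0" "rotate e w = w" for e
    unfolding d_def by (rule Least_le) (use that in simp)
  have mult: "rotate (d * j) w = w" for j
  proof (induction j)
    case (Suc j)
    have "rotate (d * Suc j) w = rotate d (rotate (d * j) w)" by (simp add: rotate_rotate)
    then show ?case using Suc d by simp
  qed simp
  have md: "rotate (k mod d) w = rotate k w" for k
  proof -
    have "rotate k w = rotate (k mod d) (rotate (d * (k div d)) w)"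
      by (simp add: rotate_rotate)
    then show ?thesis by (simp add: mult)
  qed
  have "rot_class w = (\<lambda>k. rotate k w) ` {..<d}"
    using md d by (auto simp: rot_class_def image_def) (metis lessThan_iff mod_less_divisor)
  moreover have "inj_on (\<lambda>k. rotate k w) {..<d}"
  proof (rule linorder_inj_onI)
    fix i j assume ij: "i < j" "i \<in> {..<d}" "j \<in> {..<d}"
    show "rotate i w \<noteq> rotate j w"
    proof
      assume "rotate i w = rotate j w"
      also have "rotate j w = rotate i (rotate (j - i) w)" using ij by (simp add: rotate_rotate)
      finally have "rotate (j - i) w = w" using rotate_inj by metis
      then show False using least[of "j - i"] ij by auto
    qed
  qed auto
  ultimately have "card (rot_class w) = d" by (simp add: card_image)
  moreover have "q mod d = 0"
    using least[of "q mod d"] md[of q] assms(2) d by (metis mod_less_divisor not_gr_zero not_le)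
  ultimately show ?thesis by auto
qed

lemma rot_class_card_1: "card (rot_class w) = 1 \<Longrightarrow> w \<noteq> [] \<Longrightarrow> \<exists>a. w = replicate (length w) a"
proof -
  assume w: "card (rot_class w) = 1" "w \<noteq> []"
  then obtain x where x: "rot_class w = {x}" by (auto simp: card_1_singleton_iff)
  have "rotate 1 w \<in> rot_class w" unfolding rot_class_def by (rule range_eqI[where x = 1]) simp
  with x have "rotate1 w = w" using self_in_rot_class[of w] by auto
  then have "card (set w) = 1" using rotate1_fixpoint_card w by blast
  then obtain a where "set w = {a}" by (auto simp: card_1_singleton_iff)
  then show ?thesis by (metis replicate_length_same singletonD)
qed

definition lists_of :: "nat \<Rightarrow> 'a set \<Rightarrow> 'a list set" where
  "lists_of k A = {w. set w \<subseteq> A \<and> length w = k}"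

lemma finite_lists_of: "finite A \<Longrightarrow> finite (lists_of k A)"
  by (simp add: lists_of_def finite_lists_length_eq)

lemma lists_of_0 [simp]: "lists_of 0 A = {[]}"
  by (auto simp: lists_of_def)

lemma lists_of_Suc: "lists_of (Suc k) A = (\<lambda>(a, w). a # w) ` (A \<times> lists_of k A)"
  by (auto simp: lists_of_def image_def length_Suc_conv)

lemma lists_of_rot_class: "w' \<in> rot_class w \<Longrightarrow> w \<in> lists_of k A \<Longrightarrow> w' \<in> lists_of k A"
  using set_rot_class length_rot_class by (fastforce simp: lists_of_def)

text \<open>Powers are products along tuples of empty words, so that the results on
  \<open>pt\<close> apply to them.\<close>

definition fpow :: "('a list \<Rightarrow>\<^sub>0 int) \<Rightarrow> nat \<Rightarrow> 'a list \<Rightarrow>\<^sub>0 int" where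
  "fpow u k = pt u (replicate k [])"

lemma fpow_0 [simp]: "fpow u 0 = frag_of []"
  and fpow_Suc: "fpow u (Suc k) = u \<star> fpow u k"
  by (simp_all add: fpow_def)

lemma fpow_Suc2: "fpow u (Suc k) = fpow u k \<star> u"
proof (induction k)
  case (Suc k)
  then show ?case by (metis fpow_Suc free_mult_assoc)
qed (simp add: fpow_Suc)

lemma fpow_expand:
  assumes "finite A"
  shows "fpow (\<Sum>a\<in>A. frag_cmul (s a) (frag_of a)) k =
    (\<Sum>w\<in>lists_of k A. frag_cmul (prod_list (map s w)) (frag_of (concat w)))"
proof (induction k)
  case (Suc k)
  have inj: "inj_on (\<lambda>(a, w). a # w) (A \<times> lists_of k A)" by (auto simp: inj_on_def)
  have "fpow (\<Sum>a\<in>A. frag_cmul (s a) (frag_of a)) (Suc k) =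
    (\<Sum>a\<in>A. \<Sum>w\<in>lists_of k A. frag_cmul (s a * prod_list (map s w)) (frag_of (a @ concat w)))"
    by (simp add: fpow_Suc Suc free_mult_sum_left free_mult_sum_right free_mult_cmul_left
        free_mult_cmul_right frag_cmul_sum sum.swap[of _ "lists_of k A"] mult.commute)
  also have "\<dots> = (\<Sum>w\<in>lists_of (Suc k) A. frag_cmul (prod_list (map s w)) (frag_of (concat w)))"
    unfolding lists_of_Suc sum.reindex[OF inj] sum.cartesian_product
    by (rule sum.cong) auto
  finally show ?case .
qed simp

lemma prod_list_rot_inv: "w' \<in> rot_class w \<Longrightarrow> prod_list (map s w') = prod_list (map (s :: 'a \<Rightarrow> int) w)"
  by (auto simp: mem_rot_class_iff mult.commute)

lemma rot_class_concat: "w' \<in> rot_class w \<Longrightarrow> rot_class (concat w') = rot_class (concat w)"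
  by (auto simp: mem_rot_class_iff rot_class_append)

lemma sum_const_frag: "(\<Sum>x\<in>A. (c :: 'a \<Rightarrow>\<^sub>0 int)) = frag_cmul (int (card A)) c"
  by (induction A rule: infinite_finite_induct) (simp_all add: frag_cmul_distrib)

lemma fdvd_sum_classes:
  assumes "finite X" "\<And>w w'. w \<in> X \<Longrightarrow> w' \<in> rot_class w \<Longrightarrow> w' \<in> X \<and> h w' = (h w :: 'b \<Rightarrow>\<^sub>0 int)"
    and "\<And>w. w \<in> X \<Longrightarrow> N dvd int (card (rot_class w))"
  shows "fdvd N (sum h X)"
proof -
  have "sum h X = (\<Sum>C\<in>rot_class ` X. \<Sum>w\<in>{w \<in> X. rot_class w = C}. h w)"
    by (rule sum.image_gen[OF assms(1)])
  moreover have "fdvd N (\<Sum>w\<in>{w \<in> X. rot_class w = C}. h w)" if C: "C \<in> rot_class ` X" for C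
  proof -
    from C obtain w0 where w0: "w0 \<in> X" "C = rot_class w0" by blast
    have inX: "w \<in> X" and h: "h w = h w0" if "w \<in> rot_class w0" for w
      using assms(2)[OF w0(1) that] by blast+
    have "{w \<in> X. rot_class w = C} = rot_class w0"
      unfolding w0(2) rot_class_eq_iff using inX by blast
    then have "(\<Sum>w\<in>{w \<in> X. rot_class w = C}. h w) = (\<Sum>w\<in>rot_class w0. h w0)"
      by (rule sum.cong) (rule h)
    then show ?thesis
      using assms(3)[OF w0(1)] by (simp add: sum_const_frag fdvd_cmul_dvd)
  qed
  ultimately show ?thesis by (simp add: fdvd_sum)
qed

lemma r_elem_expand:
  obtains A s where "finite A" "r_elem n = (\<Sum>a\<in>A. frag_cmul (s a) (frag_of a))"
    "A = (\<lambda>i. [Xvar i, Yvar i]) ` {1..n} \<union> (\<lambda>i. [Yvar i, Xvar i]) ` {1..n}"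
    "\<And>i. s [Xvar i, Yvar i] = 1" "\<And>i. s [Yvar i, Xvar i] = (-1 :: int)"
proof
  let ?X = "\<lambda>i. [Xvar i, Yvar i]" and ?Y = "\<lambda>i. [Yvar i, Xvar i]"
  let ?A = "?X ` {1..n} \<union> ?Y ` {1..n}"
  \<comment> \<open>The index i is read off the first letter, so that the sign tests for x_i
    y_i.\<close>
  let ?s = "\<lambda>w. if w = ?X (case hd w of Xvar i \<Rightarrow> i | Yvar i \<Rightarrow> i) then 1 else - 1 :: int"
  show "finite ?A" by simp
  have "(\<Sum>a\<in>?A. frag_cmul (?s a) (frag_of a)) =
      (\<Sum>a\<in>?X ` {1..n}. frag_cmul (?s a) (frag_of a)) + (\<Sum>a\<in>?Y ` {1..n}. frag_cmul (?s a) (frag_of a))"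
    by (rule sum.union_disjoint) auto
  also have "\<dots> = r_elem n"
    by (simp add: sum.reindex inj_on_def r_elem_eq sum_subtractf sum_negf)
  finally show "r_elem n = (\<Sum>a\<in>?A. frag_cmul (?s a) (frag_of a))" ..
qed auto

lemma rot_class_concat_replicate_swap:
  "k \<ge> 1 \<Longrightarrow> rot_class (concat (replicate k [a, b])) = rot_class (concat (replicate k [b, a]))"
proof -
  have "concat (replicate m [a, b]) @ [a] = a # concat (replicate m [b, a])" for m
    by (induction m) auto
  moreover assume "k \<ge> 1"
  then obtain m where "k = Suc m" by (cases k) auto
  ultimately show ?thesis
    using rot_class_append[of "[a]" "b # concat (replicate m [a, b])"] by simp
qed

text \<open>The power is expanded over words in the monomials of r. Non-constant words form rotation
  classes whose sizes are powers of p other than 1. The constant words in x_i y_i and in y_i x_i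
  give the same cyclic word, with total coefficient 1 + (-1)^(p^l), which is 2 for p = 2 and 0 for
  odd p.\<close>

lemma cy_r_power_fdvd:
  assumes "prime p" "l \<ge> 1"
  shows "fdvd (int p) (cy (fpow (r_elem n) (p ^ l)))"
proof -
  obtain A s where A: "finite A" "r_elem n = (\<Sum>a\<in>A. frag_cmul (s a) (frag_of a))"
    "A = (\<lambda>i. [Xvar i, Yvar i]) ` {1..n} \<union> (\<lambda>i. [Yvar i, Xvar i]) ` {1..n}"
    "\<And>i. s [Xvar i, Yvar i] = 1" "\<And>i. s [Yvar i, Xvar i] = (-1 :: int)"
    using r_elem_expand[of n] by blast
  let ?q = "p ^ l"
  let ?L = "lists_of ?q A" and ?D = "(\<lambda>a. replicate ?q a) ` A"
  let ?h = "\<lambda>w. frag_cmul (prod_list (map s w)) (frag_of (rot_class (concat w)))"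
  have q: "?q \<ge> 1" "p dvd ?q" using assms prime_gt_0_nat[of p] by (auto simp: Suc_le_eq)
  have fL: "finite ?L" using A(1) by (rule finite_lists_of)
  have DL: "?D \<subseteq> ?L" by (auto simp: lists_of_def)
  have "cy (fpow (r_elem n) ?q) = sum ?h ?L"
    unfolding A(2) fpow_expand[OF A(1)] cy_sum by (simp add: cy_cmul)
  also have "\<dots> = sum ?h ?D + sum ?h (?L - ?D)"
    using sum.subset_diff[OF DL fL] by (simp add: add.commute)
  finally have eq: "cy (fpow (r_elem n) ?q) = sum ?h ?D + sum ?h (?L - ?D)" .
  have "fdvd (int p) (sum ?h (?L - ?D))"
  proof (rule fdvd_sum_classes)
    fix w w' assume w: "w \<in> ?L - ?D" and w': "w' \<in> rot_class w"
    have "w' \<notin> ?D"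
    proof
      assume "w' \<in> ?D"
      then obtain a where a: "a \<in> A" "w' = replicate ?q a" by blast
      then have "set w \<subseteq> {a}" "length w = ?q" using set_rot_class[OF w'] length_rot_class[OF w'] by auto
      then have "w = replicate ?q a" by (metis replicate_length_same singletonD subsetD)
      then show False using w a by auto
    qed
    then show "w' \<in> ?L - ?D \<and> ?h w' = ?h w"
      using lists_of_rot_class[OF w'] w prod_list_rot_inv[OF w'] rot_class_concat[OF w'] by auto
  next
    fix w assume w: "w \<in> ?L - ?D"
    then have len: "length w = ?q" by (simp add: lists_of_def)
    have "card (rot_class w) dvd ?q"
      by (rule card_rot_class_dvd) (use q len in auto)
    then obtain i where i: "card (rot_class w) = p ^ i"
      using assms(1) divides_primepow_nat by blast
    have "i \<noteq> 0"
    proof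
      assume "i = 0"
      then have "\<exists>a. w = replicate (length w) a" using i len q by (intro rot_class_card_1) auto
      then obtain a where a: "w = replicate ?q a" using len by auto
      then have "a \<in> A" using w q by (auto simp: lists_of_def)
      then show False using a w by blast
    qed
    then show "int p dvd int (card (rot_class w))" by (simp add: i)
  qed (use A(1) in \<open>simp add: finite_lists_of\<close>)
  moreover have "fdvd (int p) (sum ?h ?D)"
  proof -
    let ?X = "\<lambda>i. [Xvar i, Yvar i]" and ?Y = "\<lambda>i. [Yvar i, Xvar i]"
    let ?k = "\<lambda>a. frag_cmul (s a ^ ?q) (frag_of (rot_class (concat (replicate ?q a))))"
    have "inj_on (\<lambda>a. replicate ?q a) A" using q by (auto simp: inj_on_def)
    then have "sum ?h ?D = sum ?k A" by (simp add: sum.reindex prod_list_replicate)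
    also have "\<dots> = sum ?k (?X ` {1..n}) + sum ?k (?Y ` {1..n})"
      unfolding A(3) by (rule sum.union_disjoint) auto
    also have "\<dots> = (\<Sum>i=1..n. ?k (?X i) + ?k (?Y i))"
      by (simp add: sum.reindex inj_on_def sum.distrib)
    finally have "sum ?h ?D = (\<Sum>i=1..n. ?k (?X i) + ?k (?Y i))" .
    moreover have "fdvd (int p) (?k (?X i) + ?k (?Y i))" for i
    proof -
      have "?k (?X i) + ?k (?Y i) = frag_cmul (1 + (-1) ^ ?q) (frag_of (rot_class (concat (replicate ?q (?X i)))))"
        using rot_class_concat_replicate_swap[OF q(1), of "Xvar i" "Yvar i"]
        by (simp add: A(4,5) frag_cmul_distrib)
      moreover have "int p dvd 1 + (-1) ^ ?q"
      proof (cases "p = 2")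
        case True
        then show ?thesis using assms(2) by simp
      next
        case False
        then have "odd p" using assms(1) prime_odd_nat prime_gt_1_nat[of p] by force
        then show ?thesis by simp
      qed
      ultimately show ?thesis by (simp only: fdvd_cmul_dvd)
    qed
    ultimately show ?thesis by (simp add: fdvd_sum)
  qed
  ultimately show ?thesis unfolding eq by (rule fdvd_add[rotated])
qed

section \<open>Coefficients of \<pi>(r_1^m) at words with a prime number of rotations\<close>

section \<open>The powers of \<open>[x\<^sub>1, y\<^sub>1]\<close>\<close>

definition wA :: "letter list" where "wA = [Xvar 1, Yvar 1]"
definition wB :: "letter list" where "wB = [Yvar 1, Xvar 1]"

text \<open>The tuple (A^(j-1) B)^k with A = x_1 y_1 and B = y_1 x_1. For prime j and k \<ge> 1 it
  has exactly j rotations, which makes j appear as a coefficient up to sign.\<close>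

definition test_tuple :: "nat \<Rightarrow> nat \<Rightarrow> letter list list" where
  "test_tuple j k = concat (replicate k (replicate (j - 1) wA @ [wB]))"

lemma length_test_tuple: "j \<ge> 1 \<Longrightarrow> length (test_tuple j k) = j * k"
  by (induction k) (auto simp: test_tuple_def)

lemma set_test_tuple: "set (test_tuple j k) \<subseteq> {wA, wB}"
  by (auto simp: test_tuple_def)

lemma card_rot_class_test_tuple:
  assumes "prime j" "k \<ge> 1"
  shows "card (rot_class (test_tuple j k)) = j"
proof -
  from assms(2) obtain m where k: "k = Suc m" by (cases k) auto
  have j: "j \<ge> 2" using assms(1) by (rule prime_ge_2_nat)
  let ?b = "replicate (j - 1) wA @ [wB]"
  have "test_tuple j k = ?b @ concat (replicate m ?b)" by (simp add: test_tuple_def k)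
  moreover have "rotate (length ?b) (?b @ concat (replicate m ?b)) = concat (replicate m ?b) @ ?b"
    by (rule rotate_append)
  moreover have "concat (replicate m ?b) @ ?b = ?b @ concat (replicate m ?b)"
    by (induction m) auto
  moreover have "length ?b = j" using j by simp
  ultimately have "rotate j (test_tuple j k) = test_tuple j k" by metis
  then have "card (rot_class (test_tuple j k)) dvd j" using j by (intro card_rot_class_dvd) auto
  moreover have "card (rot_class (test_tuple j k)) \<noteq> 1"
  proof
    assume "card (rot_class (test_tuple j k)) = 1"
    then obtain a where "test_tuple j k = replicate (length (test_tuple j k)) a"
      using rot_class_card_1[of "test_tuple j k"] by (auto simp: test_tuple_def k)
    then have "set (test_tuple j k) \<subseteq> {a}" by (metis set_replicate_conv_if subset_singleton_iff subsetI empty_subsetI order_refl)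
    moreover have "wA \<in> set (test_tuple j k)" "wB \<in> set (test_tuple j k)" using j by (auto simp: test_tuple_def k)
    ultimately show False by (auto simp: wA_def wB_def)
  qed
  ultimately show ?thesis using assms(1) by (auto simp: prime_nat_iff)
qed

lemma nth_concat_pairs:
  "\<forall>a\<in>set w. length a = 2 \<Longrightarrow> i < length w \<Longrightarrow> e < 2 \<Longrightarrow> concat w ! (2 * i + e) = w ! i ! e"
proof (induction w arbitrary: i)
  case (Cons a w)
  then show ?case by (cases i) (auto simp: nth_append)
qed simp

lemma length_concat_pairs: "\<forall>a\<in>set w. length a = 2 \<Longrightarrow> length (concat w) = 2 * length w"
  by (induction w) auto

text \<open>
  A rotation of \<open>concat (test_tuple j k)\<close> by an odd distance splits into pairs one of which
  is \<open>y\<^sub>1 y\<^sub>1\<close>, at the junction of \<open>x\<^sub>1 y\<^sub>1\<close> and \<open>y\<^sub>1 x\<^sub>1\<close>.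
\<close>

lemma test_tuple_rot_class:
  assumes "j \<ge> 2" "k \<ge> 1" "w \<in> lists_of (j * k) {wA, wB}"
    and "rot_class (concat w) = rot_class (concat (test_tuple j k))"
  shows "w \<in> rot_class (test_tuple j k)"
proof -
  let ?t = "test_tuple j k"
  have lent: "length ?t = j * k" using assms(1) by (simp add: length_test_tuple)
  have lenw: "length w = j * k" "set w \<subseteq> {wA, wB}" using assms(3) by (auto simp: lists_of_def)
  have w2: "\<forall>a\<in>set w. length a = 2" and t2: "\<forall>a\<in>set ?t. length a = 2"
    using lenw(2) set_test_tuple[of j k] by (auto simp: wA_def wB_def)
  from assms(4) have "concat w \<in> rot_class (concat ?t)" by (metis self_in_rot_class)
  then obtain s where s0: "concat w = rotate s (concat ?t)" by (auto simp: rot_class_def)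
  define M where "M = 2 * (j * k)"
  have M: "length (concat ?t) = M" "length (concat w) = M"
    using length_concat_pairs[OF t2] length_concat_pairs[OF w2] lent lenw by (simp_all add: M_def)
  have "j * k \<ge> j" using assms(2) by simp
  moreover from this have "j * k \<ge> 2" using assms(1) by linarith
  ultimately have jk: "j * k \<ge> j" "j * k \<ge> 2" by auto
  have Mge: "M \<ge> 2 * j" "M > 0" "even M" using jk assms(1) by (auto simp: M_def)
  define s' where "s' = s mod M"
  have s': "concat w = rotate s' (concat ?t)" "s' < M"
    using s0 Mge rotate_conv_mod[of s "concat ?t"] by (simp_all add: M s'_def)
  show ?thesis
  proof (cases "even s'")
    case True
    then obtain h where h: "s' = 2 * h" by (elim evenE)
    have hl: "h \<le> length ?t" using h s'(2) lent by (simp add: M_def)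
    let ?u = "take h ?t" and ?v = "drop h ?t"
    have "length (concat ?u) = s'"
      using length_concat_pairs[of ?u] t2 hl h by (auto dest: in_set_takeD)
    then have "rotate s' (concat ?u @ concat ?v) = concat ?v @ concat ?u"
      using rotate_append[of "concat ?u" "concat ?v"] by simp
    then have "concat w = concat (?v @ ?u)"
      using s'(1) by (metis append_take_drop_id concat_append)
    moreover have "length w = length (?v @ ?u)" using lenw lent hl by simp
    moreover have "\<forall>(x, y)\<in>set (zip w (?v @ ?u)). length x = length y"
    proof (rule ballI, clarify)
      fix x y assume "(x, y) \<in> set (zip w (?v @ ?u))"
      then have "x \<in> set w" "y \<in> set (?v @ ?u)" using set_zip_leftD set_zip_rightD by fast+
      moreover from this(2) have "y \<in> set ?t" by (auto dest: in_set_takeD in_set_dropD)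
      ultimately show "length x = length y" using w2 t2 by simp
    qed
    ultimately have "w = ?v @ ?u" by (rule concat_injective)
    then show ?thesis by (metis append_take_drop_id mem_rot_class_iff)
  next
    case False
    \<comment> \<open>The junction y_1 y_1 occupies positions 2j-3 and 2j-2 of
      \<open>concat ?t\<close>, and \<open>e\<close> is where position 2j-3 lands after the
      rotation; adding M keeps the subtraction of s' exact. As s' is odd, \<open>e\<close> is even
      and the junction forms one pair of \<open>w\<close>.\<close>
    define e where "e = (M + (2 * j - 3) - s') mod M"
    have "even (M + (2 * j - 3) - s')" using False Mge assms(1) s'(2) by auto
    then have "even e" using Mge(3) unfolding e_def by (simp add: dvd_mod)
    then obtain i where i: "e = 2 * i" by (elim evenE)
    have eM: "e < M" using Mge by (simp add: e_def)
    then have i2: "i < length w" using i lenw by (simp add: M_def)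
    have e1: "Suc e < M" using eM i Mge(3) by (metis Suc_lessI even_Suc even_mult_iff even_numeral)
    have mod1: "(s' + e) mod M = 2 * j - 3"
    proof -
      have "(s' + e) mod M = (s' + (M + (2 * j - 3) - s')) mod M"
        unfolding e_def by (simp add: mod_add_right_eq)
      also have "\<dots> = (M + (2 * j - 3)) mod M" using s'(2) by simp
      also have "\<dots> = (2 * j - 3) mod M" by (rule mod_add_self1)
      also have "\<dots> = 2 * j - 3" using Mge(1) assms(1) by (intro mod_less) arith
      finally show ?thesis .
    qed
    have mod2: "(s' + Suc e) mod M = 2 * j - 2"
    proof -
      have "(s' + Suc e) mod M = Suc ((s' + e) mod M) mod M" by (simp add: mod_Suc_eq)
      also have "\<dots> = 2 * j - 2" using mod1 Mge assms(1) by simp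
      finally show ?thesis .
    qed
    from assms(2) obtain m where k: "k = Suc m" by (cases k) auto
    have "j - 2 < j - 1" using assms(1) by arith
    then have tA: "?t ! (j - 2) = wA" and tB: "?t ! (j - 1) = wB"
      using assms(1) by (simp_all add: test_tuple_def k nth_append)
    have lt: "j - 2 < length ?t" "j - 1 < length ?t"
      using less_le_trans[OF _ jk(1), of "j - 2"] less_le_trans[OF _ jk(1), of "j - 1"] assms(1) lent by auto
    have idx: "Suc (2 * (j - 2)) = 2 * j - 3" using assms(1) by arith
    have "concat w ! (2 * i + 0) = concat ?t ! (2 * (j - 2) + 1)"
      using s'(1) mod1 eM i M assms(1) nth_rotate[of e "concat ?t" s']
      by (simp add: idx)
    also have "\<dots> = ?t ! (j - 2) ! 1"
      using lt by (intro nth_concat_pairs[OF t2]) auto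
    finally have 1: "w ! i ! 0 = Yvar 1"
      using nth_concat_pairs[OF w2 i2, of 0] by (simp add: tA wA_def)
    have "concat w ! (2 * i + 1) = concat ?t ! (2 * (j - 1) + 0)"
      using s'(1) mod2 e1 i M nth_rotate[of "Suc e" "concat ?t" s'] by (simp add: diff_mult_distrib2)
    also have "\<dots> = ?t ! (j - 1) ! 0"
      using lt by (intro nth_concat_pairs[OF t2]) auto
    finally have 2: "w ! i ! 1 = Yvar 1"
      using nth_concat_pairs[OF w2 i2, of 1] by (simp add: tB[unfolded One_nat_def] wB_def)
    have "w ! i \<in> {wA, wB}" using i2 lenw(2) nth_mem by blast
    then show ?thesis using 1 2 by (auto simp: wA_def wB_def)
  qed
qed

lemma keys_fpow_length:
  "Poly_Mapping.keys (cy (fpow (rpart 1) m)) \<subseteq> {C. \<forall>w\<in>C. length w = 2 * m}"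
proof -
  have "Poly_Mapping.keys (fpow (rpart 1) m) \<subseteq> {w. length w = 2 * m}"
  proof (induction m)
    case (Suc m)
    have "Poly_Mapping.keys (rpart 1) \<subseteq> {w. length w = 2}"
      unfolding rpart_def by (rule order_trans[OF keys_diff]) auto
    moreover have "Poly_Mapping.keys (free_mult f g) \<subseteq>
      (\<Union>u\<in>Poly_Mapping.keys f. \<Union>v\<in>Poly_Mapping.keys g. {u @ v})" for f g :: "letter list \<Rightarrow>\<^sub>0 int"
      unfolding free_mult_def
      by (rule order_trans[OF keys_frag_extend]) (rule UN_mono[OF order_refl],
          rule order_trans[OF keys_frag_extend], auto)
    ultimately show ?case unfolding fpow_Suc using Suc by fastforce
  qed simp
  then show ?thesis
    unfolding cy_def using length_rot_class
    by (intro order_trans[OF keys_frag_extend]) fastforce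
qed

text \<open>By \<open>test_tuple_rot_class\<close> the words in \<open>wA\<close>, \<open>wB\<close>
  with this cyclic word are exactly the j rotations of the test tuple, and all carry the same
  sign.\<close>

lemma lookup_fpow_rpart:
  assumes "prime j" "k \<ge> 1"
  obtains \<epsilon> :: int where "\<epsilon> = 1 \<or> \<epsilon> = -1"
    "Poly_Mapping.lookup (cy (fpow (rpart 1) (j * k))) (rot_class (concat (test_tuple j k))) = \<epsilon> * int j"
proof -
  let ?t = "test_tuple j k" and ?A = "{wA, wB}"
  let ?C = "rot_class (concat ?t)"
  define s where "s = (\<lambda>w. if w = wA then 1 else - 1 :: int)"
  let ?p = "\<lambda>w. prod_list (map s w)"
  have j: "j \<ge> 2" using assms(1) by (rule prime_ge_2_nat)
  have AB: "wA \<noteq> wB" by (simp add: wA_def wB_def)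
  have t: "?t \<in> lists_of (j * k) ?A"
    using set_test_tuple[of j k] j by (auto simp: lists_of_def length_test_tuple)
  have "rpart 1 = (\<Sum>a\<in>?A. frag_cmul (s a) (frag_of a))"
    using AB by (simp add: s_def) (simp add: rpart_def wA_def wB_def)
  then have "cy (fpow (rpart 1) (j * k)) =
      (\<Sum>w\<in>lists_of (j * k) ?A. frag_cmul (?p w) (frag_of (rot_class (concat w))))"
    by (simp add: fpow_expand cy_sum cy_cmul)
  then have "Poly_Mapping.lookup (cy (fpow (rpart 1) (j * k))) ?C =
      (\<Sum>w\<in>lists_of (j * k) ?A. if rot_class (concat w) = ?C then ?p w else 0)"
    by (simp add: lookup_sum if_distrib eq_commute cong: if_cong)
  also have "\<dots> = sum ?p {w \<in> lists_of (j * k) ?A. rot_class (concat w) = ?C}"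
    by (simp add: sum.inter_filter finite_lists_of)
  also have "{w \<in> lists_of (j * k) ?A. rot_class (concat w) = ?C} = rot_class ?t"
    using test_tuple_rot_class[OF j assms(2)] lists_of_rot_class[OF _ t] rot_class_concat by blast
  also have "sum ?p (rot_class ?t) = (\<Sum>w\<in>rot_class ?t. ?p ?t)"
    by (rule sum.cong) (auto simp: prod_list_rot_inv)
  also have "\<dots> = ?p ?t * int j"
    by (simp add: card_rot_class_test_tuple[OF assms])
  finally have "Poly_Mapping.lookup (cy (fpow (rpart 1) (j * k))) ?C = ?p ?t * int j" .
  moreover have "?p w = 1 \<or> ?p w = - 1" for w
    by (induction w) (auto simp: s_def)
  ultimately show ?thesis using that by blast
qed

text \<open>Different powers of r_1 have different degrees, so the coefficient at the test word sees
  only the power with exponent j k, with factor j up to sign.\<close>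

lemma const_part_dvd:
  assumes "Poly_Mapping.keys \<kappa> \<subseteq> range (\<lambda>m. replicate m [])"
    and "fdvd N (cy (frag_extend (pt (rpart 1)) \<kappa>))" "prime j" "k \<ge> 1"
  shows "N dvd Poly_Mapping.lookup \<kappa> (replicate (j * k) []) * int j"
proof -
  let ?C = "rot_class (concat (test_tuple j k))"
  obtain \<epsilon> :: int where \<epsilon>: "\<epsilon> = 1 \<or> \<epsilon> = -1"
    "Poly_Mapping.lookup (cy (fpow (rpart 1) (j * k))) ?C = \<epsilon> * int j"
    using lookup_fpow_rpart[OF assms(3,4)] by blast
  have j: "j \<ge> 2" using assms(3) by (rule prime_ge_2_nat)
  have t2: "\<forall>a\<in>set (test_tuple j k). length a = 2"
    using set_test_tuple[of j k] by (auto simp: wA_def wB_def)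
  have "Poly_Mapping.lookup (cy (frag_extend (pt (rpart 1)) \<kappa>)) ?C =
    Poly_Mapping.lookup \<kappa> (replicate (j * k) []) * (\<epsilon> * int j)"
    using assms(1)
  proof (induction rule: frag_induction)
    case (one bs)
    then obtain m where m: "bs = replicate m []" by blast
    show ?case
    proof (cases "m = j * k")
      case True
      then show ?thesis using \<epsilon>(2) by (simp add: m flip: fpow_def)
    next
      case False
      then have "length (concat (test_tuple j k)) \<noteq> 2 * m"
        using length_concat_pairs[OF t2] j by (simp add: length_test_tuple)
      then have "?C \<notin> Poly_Mapping.keys (cy (fpow (rpart 1) m))"
        using keys_fpow_length[of m] self_in_rot_class by blast
      then show ?thesis using False
        by (simp add: m in_keys_iff flip: fpow_def)
    qed
  qed (simp_all add: frag_extend_linear cy_linear lookup_minus left_diff_distrib)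
  moreover have "N dvd Poly_Mapping.lookup (cy (frag_extend (pt (rpart 1)) \<kappa>)) ?C"
    by (rule fdvd_lookup[OF assms(2)])
  ultimately show ?thesis using \<epsilon>(1) by auto
qed

section \<open>The equation p a = \<phi>(F) modulo p and modulo p^2\<close>

section \<open>Torsion in terms of cyclic words\<close>

definition const_tuples :: "letter list list set" where
  "const_tuples = {replicate m [] |m. m \<ge> 1}"

lemma nonconst_iff: "bs \<noteq> [] \<Longrightarrow> nonconst bs \<longleftrightarrow> bs \<notin> const_tuples"
proof -
  assume "bs \<noteq> []"
  moreover have "\<not> nonconst bs \<Longrightarrow> bs = replicate (length bs) []"
    unfolding nonconst_def by (metis replicate_length_same)
  moreover have "bs \<noteq> [] \<Longrightarrow> length bs \<ge> 1" by (cases bs) auto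
  ultimately show ?thesis by (auto simp: const_tuples_def nonconst_def)
qed

lemma keys_const_part:
  "Poly_Mapping.keys \<tau> \<subseteq> ntuples \<Longrightarrow> Poly_Mapping.keys (\<tau> - nonconst_part \<tau>) \<subseteq> const_tuples"
proof (induction rule: frag_induction)
  case (one bs)
  then show ?case by (auto simp: nonconst_part_def nonconst_iff ntuples_def)
next
  case (diff a b)
  have "a - b - nonconst_part (a - b) = (a - nonconst_part a) - (b - nonconst_part b)"
    by (simp add: nonconst_part_def frag_extend_linear)
  then show ?case
    using diff keys_diff[of "a - nonconst_part a" "b - nonconst_part b"] by (metis (no_types, lifting) Un_subset_iff order_trans sup.absorb2)
qed (simp add: nonconst_part_def)

lemma lookup_nonconst_part:
  "\<not> nonconst bs \<Longrightarrow> Poly_Mapping.lookup (nonconst_part \<tau>) bs = 0"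
  by (induction \<tau> rule: frag_induct) (auto simp: nonconst_part_def frag_extend_linear lookup_minus)

lemma frag_extend_evt_mult:
  "Poly_Mapping.keys \<tau> \<subseteq> ntuples \<Longrightarrow> frag_extend (evt u) \<tau> \<star> u = frag_extend (pt u) \<tau>"
  by (induction rule: frag_induction) (auto simp: frag_extend_linear free_mult_linear evt_mult ntuples_def)

text \<open>Restricting \<phi>(F) to \<open>xy\<close> turns r into r_1. The non-constant tuples
  contribute a multiple of N, by \<open>nonconst_part_fdvd\<close> and rotation invariance, so the
  remaining combination of powers of r_1 is divisible by N as well.\<close>

lemma core_const_dvd:
  assumes "n \<ge> 2" "Poly_Mapping.keys \<tau> \<subseteq> ntuples" "restr xy F = frag_extend (evt (rpart 1)) \<tau>"
    and "fdvd N (cy (F \<star> r_elem n))" "prime j" "k \<ge> 1"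
  shows "N dvd Poly_Mapping.lookup \<tau> (replicate (j * k) []) * int j"
proof -
  define \<kappa> where "\<kappa> = \<tau> - nonconst_part \<tau>"
  have "fdvd N (cy (restr xy (F \<star> r_elem n)))" by (rule restr_cy_fdvd[OF assms(4)])
  also have "restr xy (F \<star> r_elem n) = frag_extend (pt (rpart 1)) \<tau>"
    using assms(1-3) by (simp add: restr_mult restr_xy_r_elem frag_extend_evt_mult)
  finally have "fdvd N (cy (frag_extend (pt (rpart 1)) \<tau>))" .
  moreover have "fdvd N (cy (frag_extend (pt (rpart 1)) (nonconst_part \<tau>)))"
    unfolding cy_frag_extend by (rule fdvd_rot_inv[OF rot_inv_pt nonconst_part_fdvd[OF assms(1-4)]])
  ultimately have "fdvd N (cy (frag_extend (pt (rpart 1)) \<kappa>))"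
    unfolding \<kappa>_def frag_extend_diff cy_diff by (rule fdvd_diff)
  moreover have "Poly_Mapping.keys \<kappa> \<subseteq> range (\<lambda>m. replicate m [])"
    using keys_const_part[OF assms(2)] unfolding \<kappa>_def const_tuples_def by blast
  ultimately have "N dvd Poly_Mapping.lookup \<kappa> (replicate (j * k) []) * int j"
    using const_part_dvd assms(5,6) by blast
  then show ?thesis by (simp add: \<kappa>_def lookup_minus lookup_nonconst_part nonconst_def)
qed

lemma other_prime_divisor:
  fixes p m :: nat
  assumes "prime p" "m \<ge> 1" "\<nexists>l. m = p ^ l"
  obtains j k where "prime j" "j \<noteq> p" "m = j * k" "k \<ge> 1"
proof -
  obtain m' where m': "m = p ^ multiplicity p m * m'" "\<not> p dvd m'"
    using assms multiplicity_decompose'[of m p] prime_gt_1_nat[OF assms(1)] by auto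
  then have "m' \<noteq> 1" using assms(3) by (metis mult.right_neutral)
  then obtain j where j: "prime j" "j dvd m'" using prime_factor_nat by blast
  then have "j dvd m" using m'(1) by (metis dvd_mult)
  then obtain k where k: "m = j * k" by (elim dvdE)
  moreover have "k \<ge> 1" using k assms(2) by (cases k) auto
  ultimately show ?thesis using that j m'(2) by blast
qed

lemma cy_rpart: "cy (rpart i) = 0"
  using rot_class_append[of "[Xvar i]" "[Yvar i]"] by (simp add: rpart_def cy_linear)

lemma cy_r_elem: "cy (r_elem n) = 0"
  using cy_rpart by (simp add: r_elem_eq rpart_def cy_sum)

definition rpow_comb :: "nat \<Rightarrow> nat \<Rightarrow> (nat \<Rightarrow>\<^sub>0 int) \<Rightarrow> letter list set \<Rightarrow>\<^sub>0 int" where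
  "rpow_comb n p = frag_extend (\<lambda>l. cy (fpow (r_elem n) (p ^ l)))"

lemma rpow_comb_fdvd:
  assumes "prime p" "Poly_Mapping.keys \<mu> \<subseteq> {1..}"
  shows "fdvd (int p) (rpow_comb n p \<mu>)"
  using assms(2)
  by (induction rule: frag_induction)
    (auto simp: rpow_comb_def frag_extend_linear fdvd_diff intro: cy_r_power_fdvd[OF assms(1)])

text \<open>Divided by p, the conclusion expresses a through the torsion classes modulo the image of
  \<phi>. Non-constant tuples, constant tuples and words with other letters are treated
  separately.\<close>

lemma torsion_generated:
  assumes "n \<ge> 2" "prime p" "frag_cmul (int p) (cy a) = cy (F \<star> r_elem n)"
  obtains \<mu> g where "Poly_Mapping.keys \<mu> \<subseteq> {1..}"
    "frag_cmul (int p) (cy a) = rpow_comb n p \<mu> + frag_cmul (int p) (cy (g \<star> r_elem n))"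
proof -
  let ?r = "r_elem n" and ?p = "int p"
  define X where "X = (\<lambda>x. \<exists>\<mu> g. Poly_Mapping.keys \<mu> \<subseteq> {1..} \<and>
    x = rpow_comb n p \<mu> + frag_cmul ?p (cy (g \<star> ?r)))"
  have n1: "n \<ge> 1" using assms(1) by simp
  have X_g: "X (frag_cmul ?p (cy (g \<star> ?r)))" for g
    unfolding X_def by (rule exI[of _ 0], rule exI[of _ g]) (simp add: rpow_comb_def)
  have X_0: "X 0" using X_g[of 0] by simp
  have X_add: "X (x + y)" if "X x" "X y" for x y
  proof -
    from that obtain \<mu> g1 \<nu> g2 where "Poly_Mapping.keys \<mu> \<subseteq> {1..}" "Poly_Mapping.keys \<nu> \<subseteq> {1..}"
      "x = rpow_comb n p \<mu> + frag_cmul ?p (cy (g1 \<star> ?r))"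
      "y = rpow_comb n p \<nu> + frag_cmul ?p (cy (g2 \<star> ?r))" unfolding X_def by blast
    then show ?thesis
      unfolding X_def using keys_add[of \<mu> \<nu>]
      by (intro exI[of _ "\<mu> + \<nu>"] exI[of _ "g1 + g2"])
        (auto simp: rpow_comb_def frag_extend_linear free_mult_linear cy_linear frag_cmul_distrib2)
  qed
  have X_sum: "X (sum h I)" if "\<And>i. i \<in> I \<Longrightarrow> X (h i)" for h and I :: "letter list list set"
    using that by (induction I rule: infinite_finite_induct) (simp_all add: X_0 X_add)
  obtain \<tau> where \<tau>: "Poly_Mapping.keys \<tau> \<subseteq> ntuples" "restr xy F = frag_extend (evt (rpart 1)) \<tau>"
    using evt_span[OF keys_restr] by blast
  have fd: "fdvd ?p (cy (F \<star> ?r))" by (rule fdvdI[of _ _ "cy a"]) (use assms(3) in simp)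
  \<comment> \<open>Putting r in place of r_1 keeps the restriction to \<open>xy\<close> and makes
    the value under \<phi> invariant under rotation of tuples.\<close>
  let ?e = "frag_extend (evt ?r)"
  define G where "G = F - ?e \<tau>"
  have "restr xy (?e \<tau>) = frag_extend (evt (rpart 1)) \<tau>"
    using \<tau>(1)
  proof (induction rule: frag_induction)
    case (one bs)
    then show ?case
      using nwords_xy restr_evt[of bs xy ?r] by (auto simp: ntuples_def restr_xy_r_elem[OF n1])
  qed (simp_all add: restr_linear frag_extend_linear)
  then have G0: "restr xy G = 0" by (simp add: G_def restr_linear \<tau>(2))
  define \<kappa> where "\<kappa> = \<tau> - nonconst_part \<tau>"
  have split: "cy (F \<star> ?r) = cy (?e (nonconst_part \<tau>) \<star> ?r) + cy (?e \<kappa> \<star> ?r) + cy (G \<star> ?r)"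
    by (simp add: G_def \<kappa>_def frag_extend_linear free_mult_linear cy_linear)
  have e_cy: "cy (?e \<sigma> \<star> ?r) = frag_extend (\<lambda>bs. cy (evt ?r bs \<star> ?r)) \<sigma>" for \<sigma>
    by (induction \<sigma> rule: frag_induct) (simp_all add: frag_extend_linear free_mult_linear cy_linear)
  \<comment> \<open>Divisibility by p holds only up to rotation of tuples, which suffices by
    \<open>rot_inv_evt\<close>.\<close>
  obtain \<tau>'' where t2: "cy (nonconst_part \<tau>) = frag_cmul ?p (cy \<tau>'')"
    using fdvd_cy_lift[OF nonconst_part_fdvd[OF assms(1) \<tau> fd]] by blast
  then have "cy (nonconst_part \<tau>) = cy (frag_cmul ?p \<tau>'')" by (simp add: cy_linear)
  then have "cy (?e (nonconst_part \<tau>) \<star> ?r) = frag_cmul ?p (cy (?e \<tau>'' \<star> ?r))"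
    unfolding e_cy frag_extend_cmul[symmetric] by (rule frag_extend_rot_inv_cong[OF rot_inv_evt])
  then have X1: "X (cy (?e (nonconst_part \<tau>) \<star> ?r))" using X_g by simp
  have X2: "X (cy (?e \<kappa> \<star> ?r))"
    unfolding e_cy unfolding frag_extend_def
  proof (rule X_sum)
    fix bs assume "bs \<in> Poly_Mapping.keys \<kappa>"
    then obtain m where m: "bs = replicate m []" "m \<ge> 1"
      using keys_const_part[OF \<tau>(1)] unfolding \<kappa>_def const_tuples_def by blast
    let ?c = "Poly_Mapping.lookup \<kappa> bs"
    have c: "?c = Poly_Mapping.lookup \<tau> bs"
      by (simp add: \<kappa>_def lookup_minus lookup_nonconst_part nonconst_def m)
    have pw: "cy (evt ?r bs \<star> ?r) = cy (fpow ?r m)" using m by (simp add: evt_mult fpow_def)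
    show "X (frag_cmul ?c (cy (evt ?r bs \<star> ?r)))"
    proof (cases "\<exists>l. m = p ^ l")
      case True
      then obtain l where l: "m = p ^ l" by blast
      show ?thesis
      proof (cases "l = 0")
        case True
        \<comment> \<open>The term with exponent 1 is \<pi>(r) = 0, as r is a sum of
          commutators.\<close>
        then show ?thesis using X_0 l by (simp add: pw fpow_Suc cy_r_elem)
      next
        case False
        then show ?thesis
          unfolding X_def pw l
          by (intro exI[of _ "frag_cmul ?c (frag_of l)"] exI[of _ 0])
            (auto simp: rpow_comb_def frag_extend_cmul m l)
      qed
    next
      case False
      then obtain j k where j: "prime j" "j \<noteq> p" "m = j * k" "k \<ge> 1"
        using other_prime_divisor[OF assms(2) m(2)] by blast
      have "?p dvd ?c * int j"
        using core_const_dvd[OF assms(1) \<tau> fd j(1,4)] unfolding c unfolding m(1) j(3) .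
      moreover have "coprime ?p (int j)" using j assms(2) by (simp add: primes_coprime)
      ultimately have "?p dvd ?c" by (simp add: coprime_dvd_mult_left_iff)
      then obtain d where "?c = ?p * d" by (elim dvdE)
      then have "frag_cmul ?c (cy (evt ?r bs \<star> ?r)) = frag_cmul ?p (cy (frag_cmul d (evt ?r bs) \<star> ?r))"
        by (simp add: free_mult_cmul_left cy_cmul)
      then show ?thesis using X_g by simp
    qed
  qed
  from X_add[OF X1 X2] obtain \<mu> g where lg: "Poly_Mapping.keys \<mu> \<subseteq> {1..}"
    "cy (?e (nonconst_part \<tau>) \<star> ?r) + cy (?e \<kappa> \<star> ?r) = rpow_comb n p \<mu> + frag_cmul ?p (cy (g \<star> ?r))"
    unfolding X_def by blast
  \<comment> \<open>What remains is \<phi>(G), where G has no words over \<open>xy\<close> alone;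
    saturation allows division by p inside the image.\<close>
  have "cy (G \<star> ?r) = frag_cmul ?p (cy a) - rpow_comb n p \<mu> - frag_cmul ?p (cy (g \<star> ?r))"
    using split lg(2) assms(3) by simp
  then have "fdvd ?p (cy (G \<star> ?r))"
    using rpow_comb_fdvd[OF assms(2) lg(1)] by (simp add: fdvd_diff)
  then obtain G' where "cy (G \<star> ?r) = frag_cmul ?p (cy (G' \<star> ?r))"
    using cy_r_saturated[OF n1 G0] assms(2) by (metis not_prime_0 of_nat_eq_0_iff)
  then have "frag_cmul ?p (cy a) = rpow_comb n p \<mu> + frag_cmul ?p (cy ((g + G') \<star> ?r))"
    using split lg(2) assms(3) by (simp add: free_mult_linear cy_linear frag_cmul_distrib2)
  then show ?thesis using that lg(1) by blast
qed

text \<open>For F = p g plus the sum of \<mu>_l r^(p^l - 1), the relation makes \<phi>(F) divisible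
  by p^2. With j = p and k = p^(l-1), \<open>core_const_dvd\<close> shows that p^2 divides p times a
  number congruent to \<mu>_l modulo p. This serves both the non-vanishing of the classes and the
  exclusion of order p^2.\<close>

lemma no_relation:
  assumes "n \<ge> 2" "prime p" "Poly_Mapping.keys \<mu> \<subseteq> {1..}"
    and "frag_cmul ((int p)\<^sup>2) (cy a) = rpow_comb n p \<mu> + frag_cmul (int p) (cy (g \<star> r_elem n))"
  shows "int p dvd Poly_Mapping.lookup \<mu> l"
proof (cases "l = 0")
  case True
  then have "l \<notin> Poly_Mapping.keys \<mu>" using assms(3) by auto
  then show ?thesis by (simp add: in_keys_iff)
next
  case False
  let ?r = "r_elem n" and ?p = "int p"
  have p0: "p > 0" using assms(2) by (rule prime_gt_0_nat)
  let ?c = "\<lambda>l. replicate (p ^ l) ([] :: letter list)"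
  have c_nt: "?c l \<in> ntuples" for l using p0 by (auto simp: ntuples_def)
  have p_inj: "p ^ i = p ^ l \<longleftrightarrow> i = l" for i l
    using prime_gt_1_nat[OF assms(2)] by (simp add: power_inject_exp)
  obtain \<sigma> where \<sigma>: "Poly_Mapping.keys \<sigma> \<subseteq> ntuples" "restr xy g = frag_extend (evt (rpart 1)) \<sigma>"
    using evt_span[OF keys_restr] by blast
  define \<rho> where "\<rho> = frag_extend (\<lambda>l. frag_of (?c l)) \<mu>"
  define \<tau> where "\<tau> = \<rho> + frag_cmul ?p \<sigma>"
  define F where "F = frag_extend (evt ?r) \<rho> + frag_cmul ?p g"
  have k\<rho>: "Poly_Mapping.keys \<rho> \<subseteq> ntuples"
    unfolding \<rho>_def using c_nt by (intro order_trans[OF keys_frag_extend] UN_least) auto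
  have "Poly_Mapping.keys (frag_cmul ?p \<sigma>) \<subseteq> ntuples" using \<sigma>(1) by auto
  with k\<rho> have k\<tau>: "Poly_Mapping.keys \<tau> \<subseteq> ntuples"
    unfolding \<tau>_def using keys_add[of \<rho> "frag_cmul ?p \<sigma>"] by blast
  have "restr xy (frag_extend (evt ?r) \<rho>) = frag_extend (evt (rpart 1)) \<rho>"
    using k\<rho>
  proof (induction rule: frag_induction)
    case (one bs)
    then show ?case
      using nwords_xy restr_evt[of bs xy ?r] assms(1) by (auto simp: ntuples_def restr_xy_r_elem)
  qed (simp_all add: restr_linear frag_extend_linear)
  then have rF: "restr xy F = frag_extend (evt (rpart 1)) \<tau>"
    by (simp add: F_def \<tau>_def restr_linear frag_extend_linear \<sigma>(2))
  have "cy (frag_extend (evt ?r) \<rho> \<star> ?r) = rpow_comb n p \<mu>"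
    unfolding frag_extend_evt_mult[OF k\<rho>]
    by (simp add: \<rho>_def frag_extend_frag_extend cy_frag_extend rpow_comb_def fpow_def)
  then have "cy (F \<star> ?r) = frag_cmul (?p\<^sup>2) (cy a)"
    using assms(4) by (simp add: F_def free_mult_linear cy_linear free_mult_cmul_left)
  then have "fdvd (?p\<^sup>2) (cy (F \<star> ?r))" by simp
  from core_const_dvd[OF assms(1) k\<tau> rF this assms(2), of "p ^ (l - 1)"]
  have "?p\<^sup>2 dvd Poly_Mapping.lookup \<tau> (replicate (p * p ^ (l - 1)) []) * ?p" using p0 by simp
  also have "p * p ^ (l - 1) = p ^ l" using False by (cases l) auto
  finally have "?p dvd Poly_Mapping.lookup \<tau> (?c l)"
    using p0 by (simp add: power2_eq_square)
  moreover have "Poly_Mapping.lookup \<rho> (?c l) = Poly_Mapping.lookup \<mu> l"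
    unfolding \<rho>_def
    by (induction \<mu> rule: frag_induct)
      (auto simp: frag_extend_linear lookup_minus p_inj)
  ultimately have "?p dvd Poly_Mapping.lookup \<mu> l + ?p * Poly_Mapping.lookup \<sigma> (?c l)"
    by (simp add: \<tau>_def lookup_add)
  then show ?thesis by (simp add: dvd_add_left_iff)
qed

section \<open>P_cyc as cyclic words and \<Pi>_cyc as the cokernel of \<phi>\<close>

section \<open>The groups \<open>P\<^sub>c\<^sub>y\<^sub>c\<close> and \<open>\<Pi>\<^sub>c\<^sub>y\<^sub>c\<close>\<close>

lemma cyc_one: "\<one>\<^bsub>cyc A\<^esub> = comm_span A"
  by (simp add: cyc_def A_FactGroup_def')

lemma cyc_proj_eq_one_iff:
  assumes "ring A" "a \<in> carrier A"
  shows "cyc_proj A a = \<one>\<^bsub>cyc A\<^esub> \<longleftrightarrow> a \<in> comm_span A"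
proof -
  interpret abelian_subgroup "comm_span A" A by (rule abelian_subgroup_comm_span[OF assms(1)])
  show ?thesis
    unfolding cyc_one cyc_proj_def using a_rcos_self[OF assms(2)] a_rcos_const by blast
qed

lemma cyc_proj_surj:
  assumes "z \<in> carrier (cyc A)"
  obtains a where "a \<in> carrier A" "z = cyc_proj A a"
  using assms by (auto simp: cyc_def A_FactGroup_def' A_RCOSETS_def' cyc_proj_def)

definition alphabet :: "nat \<Rightarrow> letter set" where
  "alphabet n = Xvar ` {1..n} \<union> Yvar ` {1..n}"

lemma P_carrier: "f \<in> carrier (P_ring n) \<longleftrightarrow> Poly_Mapping.keys f \<subseteq> lists (alphabet n)"
  by (simp add: P_ring_def free_ring_def alphabet_def)

lemma P_ops:
  "f \<oplus>\<^bsub>P_ring n\<^esub> g = f + g" "f \<otimes>\<^bsub>P_ring n\<^esub> g = f \<star> g"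
  "\<zero>\<^bsub>P_ring n\<^esub> = 0" "\<one>\<^bsub>P_ring n\<^esub> = frag_of []"
  by (simp_all add: P_ring_def free_ring_def)

lemma P_closed:
  "f \<in> carrier (P_ring n) \<Longrightarrow> g \<in> carrier (P_ring n) \<Longrightarrow> f + g \<in> carrier (P_ring n)"
  "f \<in> carrier (P_ring n) \<Longrightarrow> g \<in> carrier (P_ring n) \<Longrightarrow> f - g \<in> carrier (P_ring n)"
  "f \<in> carrier (P_ring n) \<Longrightarrow> g \<in> carrier (P_ring n) \<Longrightarrow> f \<star> g \<in> carrier (P_ring n)"
  "f \<in> carrier (P_ring n) \<Longrightarrow> - f \<in> carrier (P_ring n)"
  "f \<in> carrier (P_ring n) \<Longrightarrow> frag_cmul k f \<in> carrier (P_ring n)"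
  "0 \<in> carrier (P_ring n)" "restr (alphabet n) h \<in> carrier (P_ring n)"
  using keys_add[of f g] keys_diff[of f g] keys_cmul[of k f]
  by (auto simp: P_carrier keys_free_mult keys_restr simp del: lists_Int_eq)

lemma P_uminus:
  assumes "f \<in> carrier (P_ring n)"
  shows "\<ominus>\<^bsub>P_ring n\<^esub> f = - f"
proof -
  interpret ring "P_ring n" by (rule ring_P_ring)
  show ?thesis using assms P_closed(4)[OF assms]
    by (intro minus_equality) (simp_all add: P_ops)
qed

lemma P_minus:
  assumes "f \<in> carrier (P_ring n)" "g \<in> carrier (P_ring n)"
  shows "f \<ominus>\<^bsub>P_ring n\<^esub> g = f - g"
  using assms by (simp add: a_minus_def P_uminus P_ops)

lemma P_commutator:
  assumes "f \<in> carrier (P_ring n)" "g \<in> carrier (P_ring n)"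
  shows "commutator (P_ring n) f g = f \<star> g - g \<star> f"
  using assms by (simp add: commutator_def P_minus P_ops P_closed)

lemma restr_alphabet_id: "f \<in> carrier (P_ring n) \<Longrightarrow> restr (alphabet n) f = f"
  by (simp add: restr_id P_carrier)

lemma fpow_carrier: "u \<in> carrier (P_ring n) \<Longrightarrow> fpow u k \<in> carrier (P_ring n)"
  by (induction k) (simp_all add: fpow_Suc P_closed, simp add: P_carrier)

lemma fpow_nat_pow: "fpow u k = u [^]\<^bsub>P_ring n\<^esub> k"
  by (induction k) (simp_all add: fpow_Suc2 nat_pow_def P_ops)

text \<open>For the converse, a word u v and the chosen representative v u of its class differ by a
  commutator; so modulo commutators every f equals an element that depends only on
  \<open>cy f\<close>.\<close>

lemma comm_span_P:
  assumes "f \<in> carrier (P_ring n)"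
  shows "f \<in> comm_span (P_ring n) \<longleftrightarrow> cy f = 0"
proof
  interpret ring "P_ring n" by (rule ring_P_ring)
  let ?P = "P_ring n"
  have inv: "inv\<^bsub>add_monoid ?P\<^esub> h = - h" if "h \<in> carrier ?P" for h
    using P_uminus[OF that] by (simp add: a_inv_def)
  assume "f \<in> comm_span ?P"
  then show "cy f = 0"
    unfolding comm_span_def
  proof (induction rule: generate.induct)
    case (incl h)
    then show ?case by (auto simp: P_commutator cy_diff cy_mult_commute)
  next
    case (inv h)
    then obtain a b where ab: "h = commutator ?P a b" "a \<in> carrier ?P" "b \<in> carrier ?P" by blast
    then have "h = a \<star> b - b \<star> a" "h \<in> carrier ?P" by (simp_all add: P_commutator P_closed)
    then show ?case using \<open>\<And>h. h \<in> carrier ?P \<Longrightarrow> inv\<^bsub>add_monoid ?P\<^esub> h = - h\<close>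
      by (simp add: cy_minus cy_diff cy_mult_commute[of a b])
  qed (simp_all add: P_ops cy_add)
next
  let ?P = "P_ring n" and ?S = "comm_span (P_ring n)"
  interpret ring "P_ring n" by (rule ring_P_ring)
  interpret S: abelian_subgroup ?S ?P by (rule abelian_subgroup_comm_span[OF ring_P_ring])
  let ?R = "frag_extend (on_classes frag_of) :: _ \<Rightarrow> letter list \<Rightarrow>\<^sub>0 int"
  have "f - ?R (cy f) \<in> ?S"
    using assms[unfolded P_carrier]
  proof (induction rule: frag_induction)
    case zero
    then show ?case using S.zero_closed by (simp add: P_ops)
  next
    case (one w)
    let ?w = "SOME x. x \<in> rot_class w"
    have "?w \<in> rot_class w" by (rule someI[of _ w]) simp
    then obtain u v where uv: "w = u @ v" "?w = v @ u" by (auto simp: mem_rot_class_iff)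
    with one have c: "frag_of u \<in> carrier ?P" "frag_of v \<in> carrier ?P" by (auto simp: P_carrier)
    have "frag_of w - ?R (cy (frag_of w)) = commutator ?P (frag_of u) (frag_of v)"
      using c uv by (simp add: P_commutator on_classes_def)
    also have "\<dots> \<in> ?S"
      unfolding comm_span_def by (rule generate.incl) (use c in blast)
    finally show ?case .
  next
    case (diff a b)
    have "(a - ?R (cy a)) \<ominus>\<^bsub>?P\<^esub> (b - ?R (cy b)) \<in> ?S"
      using diff S.a_inv_closed S.a_closed unfolding a_minus_def by blast
    moreover have "a - ?R (cy a) \<in> carrier ?P" "b - ?R (cy b) \<in> carrier ?P"
      using diff S.a_Hcarr by blast+
    ultimately show ?case by (simp add: P_minus cy_linear frag_extend_linear algebra_simps)
  qed
  moreover assume "cy f = 0"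
  ultimately show "f \<in> ?S" by simp
qed

lemma cyc_proj_P_eq_iff:
  assumes "a \<in> carrier (P_ring n)" "b \<in> carrier (P_ring n)"
  shows "cyc_proj (P_ring n) a = cyc_proj (P_ring n) b \<longleftrightarrow> cy a = cy b"
proof -
  let ?P = "P_ring n" and ?S = "comm_span (P_ring n)"
  interpret ring "P_ring n" by (rule ring_P_ring)
  interpret S: abelian_subgroup ?S ?P by (rule abelian_subgroup_comm_span[OF ring_P_ring])
  have "cyc_proj ?P a = cyc_proj ?P b \<longleftrightarrow> a \<in> ?S +>\<^bsub>?P\<^esub> b"
    unfolding cyc_proj_def
    using S.a_repr_independence'[OF _ assms(2)] S.a_rcos_self[OF assms(1)] by blast
  also have "\<dots> \<longleftrightarrow> a - b \<in> ?S"
    using S.a_rcos_module_minus[OF ring_P_ring assms(2,1)] P_minus[OF assms] by simp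
  also have "\<dots> \<longleftrightarrow> cy a = cy b"
    using assms by (simp add: comm_span_P P_closed cy_diff)
  finally show ?thesis .
qed

abbreviation rideal :: "nat \<Rightarrow> (letter list \<Rightarrow>\<^sub>0 int) set" where
  "rideal n \<equiv> Idl\<^bsub>P_ring n\<^esub> {r_elem n}"

lemma ideal_rideal: "ideal (rideal n) (P_ring n)"
  by (intro ring.genideal_ideal ring_P_ring) (simp add: r_elem_closed)

lemma Pi_proj_hom: "Pi_proj n \<in> ring_hom (P_ring n) (Pi_ring n)"
  using ideal.rcos_ring_hom[OF ideal_rideal] by (simp add: Pi_ring_def Pi_proj_def[abs_def])

lemma ring_hom_ring_Pi_proj: "ring_hom_ring (P_ring n) (Pi_ring n) (Pi_proj n)"
  by (rule ring_hom_ringI2[OF ring_P_ring ring_Pi_ring Pi_proj_hom])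

lemma Pi_proj_surj:
  assumes "x \<in> carrier (Pi_ring n)"
  obtains a where "a \<in> carrier (P_ring n)" "x = Pi_proj n a"
  using assms by (auto simp: Pi_ring_def FactRing_def A_RCOSETS_def' Pi_proj_def)

lemma Pi_proj_eq_iff:
  assumes "a \<in> carrier (P_ring n)" "b \<in> carrier (P_ring n)"
  shows "Pi_proj n a = Pi_proj n b \<longleftrightarrow> a - b \<in> rideal n"
proof -
  interpret I: ideal "rideal n" "P_ring n" by (rule ideal_rideal)
  have "Pi_proj n a = Pi_proj n b \<longleftrightarrow> a \<in> rideal n +>\<^bsub>P_ring n\<^esub> b"
    unfolding Pi_proj_def
    using I.a_repr_independence'[OF _ assms(2)] I.a_rcos_self[OF assms(1)] by blast
  also have "\<dots> \<longleftrightarrow> a - b \<in> rideal n"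
    using I.a_rcos_module_minus[OF ring_P_ring assms(2,1)] P_minus[OF assms] by simp
  finally show ?thesis .
qed

text \<open>Elements all of whose multiples a j b have cyclic image in the image of \<phi> form a
  two-sided ideal. It contains r because a r b is cyclically b a r.\<close>

lemma rideal_cy:
  assumes "j \<in> rideal n"
  shows "\<exists>f. cy j = cy (f \<star> r_elem n)"
proof -
  let ?P = "P_ring n" and ?r = "r_elem n"
  interpret ring "P_ring n" by (rule ring_P_ring)
  define M where "M = {j \<in> carrier ?P. \<forall>a\<in>carrier ?P. \<forall>b\<in>carrier ?P. \<exists>f. cy (a \<star> (j \<star> b)) = cy (f \<star> ?r)}"
  have MD: "\<exists>f. cy (a \<star> (x \<star> b)) = cy (f \<star> ?r)"
    if "x \<in> M" "a \<in> carrier ?P" "b \<in> carrier ?P" for a x b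
    using that unfolding M_def by blast
  have "ideal M ?P"
  proof (rule idealI[OF ring_P_ring])
    show "subgroup M (add_monoid ?P)"
    proof (rule add.subgroupI)
      show "M \<subseteq> carrier ?P" by (auto simp: M_def)
      have "0 \<in> M" by (auto simp: M_def P_closed intro: exI[of _ 0])
      then show "M \<noteq> {}" by blast
    next
      fix x assume x: "x \<in> M"
      then have "x \<in> carrier ?P" by (simp add: M_def)
      moreover have "\<exists>f. cy (a \<star> (- x \<star> b)) = cy (f \<star> ?r)" if ab: "a \<in> carrier ?P" "b \<in> carrier ?P" for a b
      proof -
        from MD[OF x ab] obtain f where "cy (a \<star> (x \<star> b)) = cy (f \<star> ?r)" by blast
        then show ?thesis
          by (intro exI[of _ "- f"]) (simp add: free_mult_minus_left free_mult_minus_right cy_minus)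
      qed
      ultimately show "\<ominus>\<^bsub>?P\<^esub> x \<in> M" unfolding M_def by (simp add: P_uminus P_closed)
    next
      fix x y assume xy: "x \<in> M" "y \<in> M"
      then have "x \<in> carrier ?P" "y \<in> carrier ?P" by (simp_all add: M_def)
      moreover have "\<exists>f. cy (a \<star> ((x + y) \<star> b)) = cy (f \<star> ?r)" if ab: "a \<in> carrier ?P" "b \<in> carrier ?P" for a b
      proof -
        from MD[OF xy(1) ab] MD[OF xy(2) ab]
        obtain f g where "cy (a \<star> (x \<star> b)) = cy (f \<star> ?r)" "cy (a \<star> (y \<star> b)) = cy (g \<star> ?r)" by blast
        then show ?thesis
          by (intro exI[of _ "f + g"]) (simp add: free_mult_linear cy_add)
      qed
      ultimately show "x \<oplus>\<^bsub>?P\<^esub> y \<in> M" unfolding M_def by (simp add: P_ops P_closed)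
    qed
  next
    fix a x assume a: "a \<in> M" and x: "x \<in> carrier ?P"
    have "\<exists>f. cy (u \<star> ((x \<star> a) \<star> v)) = cy (f \<star> ?r)" if "u \<in> carrier ?P" "v \<in> carrier ?P" for u v
    proof -
      have "u \<star> x \<in> carrier ?P" using that x by (simp add: P_closed)
      from MD[OF a this that(2)] obtain f where "cy ((u \<star> x) \<star> (a \<star> v)) = cy (f \<star> ?r)" by blast
      then show ?thesis by (auto simp: free_mult_assoc)
    qed
    then show "x \<otimes>\<^bsub>?P\<^esub> a \<in> M" using a x by (simp add: M_def P_ops P_closed)
    have "\<exists>f. cy (u \<star> ((a \<star> x) \<star> v)) = cy (f \<star> ?r)" if "u \<in> carrier ?P" "v \<in> carrier ?P" for u v
    proof -
      have "x \<star> v \<in> carrier ?P" using that x by (simp add: P_closed)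
      from MD[OF a that(1) this] obtain f where "cy (u \<star> (a \<star> (x \<star> v))) = cy (f \<star> ?r)" by blast
      then show ?thesis by (auto simp: free_mult_assoc)
    qed
    then show "a \<otimes>\<^bsub>?P\<^esub> x \<in> M" using a x by (simp add: M_def P_ops P_closed)
  qed
  moreover have "?r \<in> M"
  proof -
    have "cy (a \<star> (?r \<star> b)) = cy (b \<star> a \<star> ?r)" for a b
      by (metis cy_mult_commute free_mult_assoc)
    then show ?thesis unfolding M_def using r_elem_closed by blast
  qed
  ultimately have "rideal n \<subseteq> M" by (intro genideal_minimal) auto
  then have "j \<in> M" using assms by blast
  from MD[OF this, of "frag_of []" "frag_of []"] show ?thesis by (simp add: P_carrier)
qed

definition Pi_class :: "nat \<Rightarrow> (letter list \<Rightarrow>\<^sub>0 int) \<Rightarrow> (letter list \<Rightarrow>\<^sub>0 int) set set" where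
  "Pi_class n a = cyc_proj (Pi_ring n) (Pi_proj n a)"

text \<open>Elements of \<Pi> lift to P, so each commutator lifts to a commutator, which
  \<open>cy\<close> kills.\<close>

lemma comm_span_Pi:
  assumes "x \<in> comm_span (Pi_ring n)"
  shows "\<exists>c\<in>carrier (P_ring n). cy c = 0 \<and> x = Pi_proj n c"
proof -
  let ?P = "P_ring n" and ?Q = "Pi_ring n"
  interpret h: ring_hom_ring ?P ?Q "Pi_proj n" by (rule ring_hom_ring_Pi_proj)
  have comm: "\<exists>c\<in>carrier ?P. cy c = 0 \<and> commutator ?Q x y = Pi_proj n c"
    if xy: "x \<in> carrier ?Q" "y \<in> carrier ?Q" for x y
  proof -
    obtain a where a: "a \<in> carrier ?P" "x = Pi_proj n a" using Pi_proj_surj[OF xy(1)] .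
    obtain b where b: "b \<in> carrier ?P" "y = Pi_proj n b" using Pi_proj_surj[OF xy(2)] .
    have "Pi_proj n (commutator ?P a b) = commutator ?Q x y"
      using a b by (simp add: commutator_def a_minus_def)
    moreover have "cy (commutator ?P a b) = 0"
      using a b by (simp add: P_commutator cy_diff cy_mult_commute)
    moreover have "commutator ?P a b \<in> carrier ?P"
      using a b by (simp add: commutator_closed ring_P_ring)
    ultimately show ?thesis by metis
  qed
  show ?thesis
    using assms unfolding comm_span_def
  proof (induction rule: generate.induct)
    case one
    have "\<zero>\<^bsub>?Q\<^esub> = Pi_proj n \<zero>\<^bsub>?P\<^esub>" by simp
    then show ?case by (intro bexI[of _ 0]) (simp_all add: P_ops P_closed)
  next
    case (incl x)
    then show ?case using comm by auto
  next
    case (inv x)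
    then obtain y z where "x = commutator ?Q y z" "y \<in> carrier ?Q" "z \<in> carrier ?Q" by blast
    with comm[of y z] obtain c where c: "c \<in> carrier ?P" "cy c = 0" "x = Pi_proj n c" by blast
    have "inv\<^bsub>add_monoid ?Q\<^esub> x = \<ominus>\<^bsub>?Q\<^esub> x" by (simp only: a_inv_def)
    also have "\<dots> = Pi_proj n (\<ominus>\<^bsub>?P\<^esub> c)" using c by simp
    finally have "inv\<^bsub>add_monoid ?Q\<^esub> x = Pi_proj n (\<ominus>\<^bsub>?P\<^esub> c)" .
    then show ?case using c by (intro bexI[of _ "- c"]) (simp_all add: P_uminus cy_minus P_closed)
  next
    case (eng x y)
    then obtain c d where c: "c \<in> carrier ?P" "cy c = 0" "x = Pi_proj n c"
      and d: "d \<in> carrier ?P" "cy d = 0" "y = Pi_proj n d" by blast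
    then have "x \<oplus>\<^bsub>?Q\<^esub> y = Pi_proj n (c \<oplus>\<^bsub>?P\<^esub> d)" by simp
    then show ?case using c d by (intro bexI[of _ "c + d"]) (simp_all add: P_ops cy_add P_closed)
  qed
qed

lemma Pi_class_eq_cyc_map:
  "a \<in> carrier (P_ring n) \<Longrightarrow> Pi_class n a = cyc_map (P_ring n) (Pi_ring n) (Pi_proj n) (cyc_proj (P_ring n) a)"
  by (simp add: Pi_class_def cyc_map_proj[OF ring_P_ring ring_Pi_ring Pi_proj_hom])

lemma comm_group_Pi: "comm_group (cyc (Pi_ring n))"
  by (rule comm_group_cyc[OF ring_Pi_ring])

lemma Pi_class_closed: "a \<in> carrier (P_ring n) \<Longrightarrow> Pi_class n a \<in> carrier (cyc (Pi_ring n))"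
  unfolding Pi_class_def
  using hom_in_carrier[OF cyc_proj_hom[OF ring_Pi_ring]] ring_hom_closed[OF Pi_proj_hom] by fastforce

lemma Pi_class_add:
  assumes "a \<in> carrier (P_ring n)" "b \<in> carrier (P_ring n)"
  shows "Pi_class n (a + b) = Pi_class n a \<otimes>\<^bsub>cyc (Pi_ring n)\<^esub> Pi_class n b"
proof -
  have "Pi_proj n (a + b) = Pi_proj n a \<oplus>\<^bsub>Pi_ring n\<^esub> Pi_proj n b"
    using ring_hom_add[OF Pi_proj_hom assms] by (simp add: P_ops)
  then show ?thesis
    unfolding Pi_class_def
    using hom_mult[OF cyc_proj_hom[OF ring_Pi_ring[of n]], of "Pi_proj n a" "Pi_proj n b"]
      ring_hom_closed[OF Pi_proj_hom] assms by simp
qed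

text \<open>This is the identification with the cokernel: a representative of a trivial class is an
  element of [P, P] plus one of the ideal of r, to which \<open>rideal_cy\<close> applies.\<close>

lemma Pi_class_eq_one_iff:
  assumes "a \<in> carrier (P_ring n)"
  shows "Pi_class n a = \<one>\<^bsub>cyc (Pi_ring n)\<^esub> \<longleftrightarrow> (\<exists>f. cy a = cy (f \<star> r_elem n))"
proof
  let ?P = "P_ring n" and ?Q = "Pi_ring n" and ?r = "r_elem n"
  interpret h: ring_hom_ring ?P ?Q "Pi_proj n" by (rule ring_hom_ring_Pi_proj)
  have one_iff: "Pi_class n b = \<one>\<^bsub>cyc ?Q\<^esub> \<longleftrightarrow> Pi_proj n b \<in> comm_span ?Q" if "b \<in> carrier ?P" for b
    unfolding Pi_class_def using that by (intro cyc_proj_eq_one_iff ring_Pi_ring) simp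
  {
    assume "Pi_class n a = \<one>\<^bsub>cyc ?Q\<^esub>"
    then have "Pi_proj n a \<in> comm_span ?Q" using one_iff assms by simp
    then obtain c where c: "c \<in> carrier ?P" "cy c = 0" "Pi_proj n a = Pi_proj n c"
      using comm_span_Pi by blast
    then have "a - c \<in> rideal n" using Pi_proj_eq_iff assms by blast
    then show "\<exists>f. cy a = cy (f \<star> ?r)" using rideal_cy[of "a - c" n] c(2) by (simp add: cy_diff)
  }
  assume "\<exists>f. cy a = cy (f \<star> ?r)"
  then obtain f' where f': "cy a = cy (f' \<star> ?r)" by blast
  \<comment> \<open>The witness may contain letters outside the alphabet of P; restricting it
    preserves the equation because a and r are unchanged.\<close>
  define f where "f = restr (alphabet n) f'"
  have fc: "f \<in> carrier ?P" "f \<star> ?r \<in> carrier ?P" by (simp_all add: f_def P_closed r_elem_closed)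
  have "cy a = cy (f \<star> ?r)"
    using restr_cy_cong[OF f', of "alphabet n"] restr_alphabet_id[OF assms] restr_alphabet_id[OF r_elem_closed]
    by (simp add: f_def restr_mult)
  then have "cyc_proj ?P a = cyc_proj ?P (f \<star> ?r)"
    using cyc_proj_P_eq_iff assms fc(2) by blast
  then have "Pi_class n a = Pi_class n (f \<star> ?r)"
    using assms fc(2) by (simp add: Pi_class_eq_cyc_map)
  moreover have "Pi_proj n (f \<star> ?r) = \<zero>\<^bsub>?Q\<^esub>"
  proof -
    interpret I: ideal "rideal n" ?P by (rule ideal_rideal)
    have "?r \<in> rideal n" by (rule ring.genideal_self'[OF ring_P_ring r_elem_closed])
    then have "f \<otimes>\<^bsub>?P\<^esub> ?r \<in> rideal n" using fc(1) by (rule I.I_l_closed)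
    then have "Pi_proj n (f \<star> ?r) = Pi_proj n 0" using fc by (simp add: Pi_proj_eq_iff P_closed P_ops)
    then show ?thesis using h.hom_zero by (simp add: P_ops)
  qed
  moreover have "\<zero>\<^bsub>?Q\<^esub> \<in> comm_span ?Q"
    unfolding comm_span_def using generate.one[of "add_monoid ?Q"] by simp
  ultimately show "Pi_class n a = \<one>\<^bsub>cyc ?Q\<^esub>" using one_iff[OF fc(2)] by simp
qed

lemma Pi_class_surj:
  assumes "z \<in> carrier (cyc (Pi_ring n))"
  obtains a where "a \<in> carrier (P_ring n)" "z = Pi_class n a"
proof -
  obtain x where "x \<in> carrier (Pi_ring n)" "z = cyc_proj (Pi_ring n) x" using cyc_proj_surj[OF assms] .
  then show ?thesis using that Pi_proj_surj unfolding Pi_class_def by metis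
qed

lemma Pi_class_0: "Pi_class n 0 = \<one>\<^bsub>cyc (Pi_ring n)\<^esub>"
  by (subst Pi_class_eq_one_iff) (auto simp: P_closed intro: exI[of _ 0])

lemma Pi_class_minus:
  assumes "a \<in> carrier (P_ring n)"
  shows "Pi_class n (- a) = inv\<^bsub>cyc (Pi_ring n)\<^esub> Pi_class n a"
proof -
  interpret comm_group "cyc (Pi_ring n)" by (rule comm_group_Pi)
  have "Pi_class n (- a) \<otimes>\<^bsub>cyc (Pi_ring n)\<^esub> Pi_class n a = \<one>\<^bsub>cyc (Pi_ring n)\<^esub>"
    using Pi_class_add[OF P_closed(4)[OF assms] assms] by (simp add: Pi_class_0)
  then show ?thesis using assms by (metis P_closed(4) Pi_class_closed inv_equality)
qed

lemma Pi_class_pow: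
  assumes "a \<in> carrier (P_ring n)"
  shows "Pi_class n a [^]\<^bsub>cyc (Pi_ring n)\<^esub> k = Pi_class n (frag_cmul (int k) a)"
proof (induction k)
  case 0
  show ?case by (simp add: Pi_class_0)
next
  case (Suc k)
  have "frag_cmul (int (Suc k)) a = frag_cmul (int k) a + a"
    by (simp add: frag_cmul_distrib add.commute)
  then show ?case using Suc assms by (simp add: Pi_class_add P_closed)
qed

lemma Pi_class_cong:
  assumes "a \<in> carrier (P_ring n)" "b \<in> carrier (P_ring n)" "cy a = cy b + cy (f \<star> r_elem n)"
  shows "Pi_class n a = Pi_class n b"
proof -
  interpret comm_group "cyc (Pi_ring n)" by (rule comm_group_Pi)
  have "Pi_class n (a - b) = \<one>\<^bsub>cyc (Pi_ring n)\<^esub>"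
    using assms by (subst Pi_class_eq_one_iff) (auto simp: P_closed cy_diff)
  then have "Pi_class n (a - b + b) = Pi_class n b"
    using assms Pi_class_add[OF P_closed(2)[OF assms(1,2)] assms(2)] Pi_class_closed by simp
  then show ?thesis by simp
qed

section \<open>The torsion classes and the structure of the torsion\<close>

section \<open>The torsion classes\<close>

lemma cyc_proj_P_pow:
  assumes "a \<in> carrier (P_ring n)"
  shows "cyc_proj (P_ring n) a [^]\<^bsub>cyc (P_ring n)\<^esub> k = cyc_proj (P_ring n) (frag_cmul (int k) a)"
proof (induction k)
  case 0
  have "cyc_proj (P_ring n) 0 = \<one>\<^bsub>cyc (P_ring n)\<^esub>"
    by (simp add: cyc_proj_eq_one_iff ring_P_ring P_closed comm_span_P)
  then show ?case by simp
next
  case (Suc k)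
  have "frag_cmul (int (Suc k)) a = frag_cmul (int k) a + a"
    by (simp add: frag_cmul_distrib add.commute)
  then show ?case
    using Suc assms hom_mult[OF cyc_proj_hom[OF ring_P_ring[of n]], of "frag_cmul (int k) a" a]
    by (simp add: P_closed P_ops)
qed

text \<open>The definite description is resolved: \<open>cy_r_power_fdvd\<close> yields the quotient
  by p, unique because the free group on cyclic words has no torsion.\<close>

lemma r_class_eq:
  assumes "prime p" "l \<ge> 1"
  obtains z where "z \<in> carrier (P_ring n)" "frag_cmul (int p) (cy z) = cy (fpow (r_elem n) (p ^ l))"
    "r_class n p l = Pi_class n z"
proof -
  let ?P = "P_ring n" and ?w = "fpow (r_elem n) (p ^ l)"
  have p0: "int p \<noteq> 0" using prime_gt_0_nat[OF assms(1)] by simp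
  have wc: "?w \<in> carrier ?P" by (rule fpow_carrier[OF r_elem_closed])
  obtain z' where z': "cy ?w = frag_cmul (int p) (cy z')"
    using fdvd_cy_lift[OF cy_r_power_fdvd[OF assms]] by blast
  define z where "z = restr (alphabet n) z'"
  have zc: "z \<in> carrier ?P" by (simp add: z_def P_closed)
  have "cy ?w = cy (frag_cmul (int p) z')" using z' by (simp add: cy_cmul)
  from restr_cy_cong[OF this, of "alphabet n"] have z: "cy ?w = cy (frag_cmul (int p) z)"
    using restr_alphabet_id[OF wc] by (simp add: z_def restr_cmul)
  have eq: "cyc_proj ?P a [^]\<^bsub>cyc ?P\<^esub> p = cyc_proj ?P ?w \<longleftrightarrow> cy a = cy z" if "a \<in> carrier ?P" for a
  proof -
    have "cyc_proj ?P a [^]\<^bsub>cyc ?P\<^esub> p = cyc_proj ?P ?w \<longleftrightarrow> frag_cmul (int p) (cy a) = frag_cmul (int p) (cy z)"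
      using that wc z by (simp add: cyc_proj_P_pow cyc_proj_P_eq_iff P_closed cy_cmul)
    also have "\<dots> \<longleftrightarrow> frag_cmul (int p) (cy a - cy z) = 0" by (simp add: frag_cmul_diff_distrib2)
    finally show ?thesis using p0 by simp
  qed
  have "(THE x. x \<in> carrier (cyc ?P) \<and>
      x [^]\<^bsub>cyc ?P\<^esub> p = cyc_proj ?P (r_elem n [^]\<^bsub>?P\<^esub> (p ^ l))) = cyc_proj ?P z"
    unfolding fpow_nat_pow[of "r_elem n" "p ^ l" n, symmetric]
  proof (rule the_equality)
    have "cyc_proj ?P z \<in> carrier (cyc ?P)"
      using hom_in_carrier[OF cyc_proj_hom[OF ring_P_ring]] zc by fastforce
    then show "cyc_proj ?P z \<in> carrier (cyc ?P) \<and> cyc_proj ?P z [^]\<^bsub>cyc ?P\<^esub> p = cyc_proj ?P ?w"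
      using eq[OF zc] by simp
  next
    fix x assume x: "x \<in> carrier (cyc ?P) \<and> x [^]\<^bsub>cyc ?P\<^esub> p = cyc_proj ?P ?w"
    then obtain a where "a \<in> carrier ?P" "x = cyc_proj ?P a" using cyc_proj_surj by blast
    then show "x = cyc_proj ?P z" using x eq zc by (simp add: cyc_proj_P_eq_iff)
  qed
  then have "r_class n p l = Pi_class n z"
    unfolding r_class_def by (simp add: Pi_class_eq_cyc_map[OF zc])
  then show ?thesis using that zc z by (simp add: cy_cmul)
qed

lemma fdvd_if_lookup:
  assumes "\<And>x. N dvd Poly_Mapping.lookup f x"
  shows "fdvd N f"
proof -
  have "f = (\<Sum>i\<in>Poly_Mapping.keys f. frag_cmul (Poly_Mapping.lookup f i) (frag_of i))"
    using frag_expansion[of f] by (simp add: frag_extend_def)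
  also have "fdvd N \<dots>" using assms by (intro fdvd_sum fdvd_cmul_dvd)
  finally show ?thesis .
qed

lemma frag_cmul_cancel: "k \<noteq> 0 \<Longrightarrow> frag_cmul k f = frag_cmul k g \<Longrightarrow> f = g"
  using frag_cmul_eq_0_iff[of k "f - g"] by (simp add: frag_cmul_diff_distrib2)

lemma rpow_comb_in_r:
  assumes "p > 0"
  shows "\<exists>f. rpow_comb n p \<nu> = cy (f \<star> r_elem n)"
proof -
  have "rpow_comb n p \<nu> = cy (frag_extend (\<lambda>l. fpow (r_elem n) (p ^ l - 1)) \<nu> \<star> r_elem n)"
  proof (induction \<nu> rule: frag_induct)
    case (2 l)
    have "p ^ l = Suc (p ^ l - 1)" using assms by simp
    then show ?case unfolding rpow_comb_def by (metis fpow_Suc2 frag_extend_of)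
  qed (simp_all add: rpow_comb_def frag_extend_linear free_mult_linear cy_linear)
  then show ?thesis by blast
qed

theorem mainTheorem1:
  fixes n p :: nat
  assumes "n \<ge> 2" and "prime p"
  shows "(\<forall>l\<ge>1. r_class n p l \<noteq> \<one>\<^bsub>cyc (Pi_ring n)\<^esub>) \<and>
         generate (cyc (Pi_ring n)) {r_class n p l |l. l \<ge> 1} =
           {z \<in> carrier (cyc (Pi_ring n)). z [^]\<^bsub>cyc (Pi_ring n)\<^esub> p = \<one>\<^bsub>cyc (Pi_ring n)\<^esub>} \<and>
         \<not> (\<exists>z \<in> carrier (cyc (Pi_ring n)). group.ord (cyc (Pi_ring n)) z = p ^ 2)"
proof (intro conjI)
  let ?P = "P_ring n" and ?r = "r_elem n" and ?G = "cyc (Pi_ring n)"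
  interpret G: comm_group ?G by (rule comm_group_Pi)
  have p0: "int p \<noteq> 0" "p > 0" using prime_gt_0_nat[OF assms(2)] by simp_all
  have "\<forall>l. \<exists>z. l \<ge> 1 \<longrightarrow> z \<in> carrier ?P \<and> frag_cmul (int p) (cy z) = cy (fpow ?r (p ^ l)) \<and> r_class n p l = Pi_class n z"
    using r_class_eq[OF assms(2)] by metis
  then obtain zl where zl: "\<And>l. l \<ge> 1 \<Longrightarrow> zl l \<in> carrier ?P"
    "\<And>l. l \<ge> 1 \<Longrightarrow> frag_cmul (int p) (cy (zl l)) = cy (fpow ?r (p ^ l))"
    "\<And>l. l \<ge> 1 \<Longrightarrow> r_class n p l = Pi_class n (zl l)" by metis
  let ?gens = "{r_class n p l |l. l \<ge> 1}"
  let ?T = "{z \<in> carrier ?G. z [^]\<^bsub>?G\<^esub> p = \<one>\<^bsub>?G\<^esub>}"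
  show "\<forall>l\<ge>1. r_class n p l \<noteq> \<one>\<^bsub>?G\<^esub>"
  proof (intro allI impI notI)
    fix l :: nat assume l: "l \<ge> 1" and "r_class n p l = \<one>\<^bsub>?G\<^esub>"
    then obtain f where f: "cy (zl l) = cy (f \<star> ?r)" using zl Pi_class_eq_one_iff by metis
    \<comment> \<open>A vanishing class gives a relation with a = 0 in which one coefficient is 1,
      so that p would divide 1.\<close>
    have "frag_cmul ((int p)\<^sup>2) (cy 0) = rpow_comb n p (frag_of l) + frag_cmul (int p) (cy (- f \<star> ?r))"
      using zl(2)[OF l] f by (simp add: rpow_comb_def free_mult_minus_left cy_minus frag_cmul_minus)
    then have "int p dvd Poly_Mapping.lookup (frag_of l) l"
      by (rule no_relation[OF assms, rotated]) (use l in simp)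
    then show False using prime_gt_1_nat[OF assms(2)] by simp
  qed
  have gens_T: "?gens \<subseteq> ?T"
  proof
    fix x assume "x \<in> ?gens"
    then obtain l where l: "l \<ge> 1" "x = Pi_class n (zl l)" using zl(3) by auto
    have "cy (frag_cmul (int p) (zl l)) = rpow_comb n p (frag_of l)"
      using zl(2)[OF l(1)] by (simp add: cy_cmul rpow_comb_def)
    then have "Pi_class n (frag_cmul (int p) (zl l)) = \<one>\<^bsub>?G\<^esub>"
      using zl(1)[OF l(1)] rpow_comb_in_r[OF p0(2), of n "frag_of l"] by (simp add: Pi_class_eq_one_iff P_closed)
    then show "x \<in> ?T" using l zl(1) by (simp add: Pi_class_pow Pi_class_closed)
  qed
  have T_sub: "subgroup ?T ?G"
    by (rule G.subgroupI) (auto simp: G.nat_pow_inv G.nat_pow_distrib)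
  show "generate ?G ?gens = ?T"
  proof (intro equalityI G.generate_subgroup_incl[OF gens_T T_sub] subsetI)
    fix x assume x: "x \<in> ?T"
    then obtain a where a: "a \<in> carrier ?P" "x = Pi_class n a" using Pi_class_surj by blast
    then have "Pi_class n (frag_cmul (int p) a) = \<one>\<^bsub>?G\<^esub>" using x by (simp add: Pi_class_pow)
    then obtain F where "frag_cmul (int p) (cy a) = cy (F \<star> ?r)"
      using a(1) by (auto simp: Pi_class_eq_one_iff P_closed cy_cmul)
    then obtain \<mu> g where mg: "Poly_Mapping.keys \<mu> \<subseteq> {1..}"
      "frag_cmul (int p) (cy a) = rpow_comb n p \<mu> + frag_cmul (int p) (cy (g \<star> ?r))"
      using torsion_generated[OF assms] by blast
    \<comment> \<open>The same combination, taken of the representatives of the torsion classes; p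
      times it is \<open>rpow_comb n p \<mu>\<close>.\<close>
    let ?z = "frag_extend zl \<mu>"
    have "rpow_comb n p \<mu> = frag_cmul (int p) (cy ?z) \<and> ?z \<in> carrier ?P \<and> Pi_class n ?z \<in> generate ?G ?gens"
      using mg(1)
    proof (induction rule: frag_induction)
      case zero
      then show ?case by (simp add: rpow_comb_def P_closed Pi_class_0 generate.one)
    next
      case (one l)
      then have "Pi_class n (zl l) \<in> generate ?G ?gens"
        using zl(3)[of l] by (intro generate.incl) auto
      then show ?case using one zl by (simp add: rpow_comb_def)
    next
      case (diff b c)
      let ?b = "frag_extend zl b" and ?c = "frag_extend zl c"
      have "Pi_class n (?b - ?c) = Pi_class n ?b \<otimes>\<^bsub>?G\<^esub> inv\<^bsub>?G\<^esub> Pi_class n ?c"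
        using diff Pi_class_add[of ?b n "- ?c"] by (simp add: Pi_class_minus P_closed)
      moreover have "?gens \<subseteq> carrier ?G" using gens_T by blast
      ultimately have "Pi_class n (?b - ?c) \<in> generate ?G ?gens"
        using diff by (simp add: generate.eng G.generate_m_inv_closed)
      then show ?case
        using diff by (simp add: rpow_comb_def frag_extend_linear cy_linear frag_cmul_diff_distrib2 P_closed)
    qed
    then have z: "rpow_comb n p \<mu> = frag_cmul (int p) (cy ?z)" "?z \<in> carrier ?P" "Pi_class n ?z \<in> generate ?G ?gens"
      by auto
    have "frag_cmul (int p) (cy a) = frag_cmul (int p) (cy ?z + cy (g \<star> ?r))"
      using mg(2) z(1) by (simp add: frag_cmul_distrib2)
    then have "cy a = cy ?z + cy (g \<star> ?r)" by (rule frag_cmul_cancel[OF p0(1)])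
    then show "x \<in> generate ?G ?gens" using Pi_class_cong[OF a(1) z(2)] a(2) z(3) by simp
  qed
  show "\<not> (\<exists>z\<in>carrier ?G. G.ord z = p ^ 2)"
  proof
    assume "\<exists>z\<in>carrier ?G. G.ord z = p ^ 2"
    then obtain z where z: "z \<in> carrier ?G" "G.ord z = p ^ 2" by blast
    obtain a where a: "a \<in> carrier ?P" "z = Pi_class n a" using Pi_class_surj[OF z(1)] .
    \<comment> \<open>The element p z is p-torsion, so \<open>torsion_generated\<close> applies to
      it. As it is itself divisible by p, \<open>no_relation\<close> makes all coefficients
      multiples of p, and p z = 0 follows.\<close>
    let ?b = "frag_cmul (int p) a"
    have b: "?b \<in> carrier ?P" using a by (simp add: P_closed)
    have "z [^]\<^bsub>?G\<^esub> (p ^ 2) = \<one>\<^bsub>?G\<^esub>" using z G.pow_ord_eq_1 by metis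
    then have "Pi_class n (frag_cmul (int p) ?b) = \<one>\<^bsub>?G\<^esub>"
      using a by (simp add: Pi_class_pow power2_eq_square)
    then obtain F where "frag_cmul (int p) (cy ?b) = cy (F \<star> ?r)"
      using b P_closed(5)[OF b, of "int p"] by (auto simp only: Pi_class_eq_one_iff cy_cmul)
    then obtain \<mu> g where mg: "Poly_Mapping.keys \<mu> \<subseteq> {1..}"
      "frag_cmul (int p) (cy ?b) = rpow_comb n p \<mu> + frag_cmul (int p) (cy (g \<star> ?r))"
      using torsion_generated[OF assms] by blast
    have "frag_cmul ((int p)\<^sup>2) (cy a) = rpow_comb n p \<mu> + frag_cmul (int p) (cy (g \<star> ?r))"
      using mg(2) by (simp add: cy_cmul power2_eq_square)
    then have "fdvd (int p) \<mu>" by (intro fdvd_if_lookup no_relation[OF assms mg(1)])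
    then obtain \<nu> where "\<mu> = frag_cmul (int p) \<nu>" by (auto simp: fdvd_def)
    then have "frag_cmul (int p) (cy ?b) = frag_cmul (int p) (rpow_comb n p \<nu> + cy (g \<star> ?r))"
      using mg(2) by (simp add: rpow_comb_def frag_extend_cmul frag_cmul_distrib2)
    then have "cy ?b = rpow_comb n p \<nu> + cy (g \<star> ?r)" by (rule frag_cmul_cancel[OF p0(1)])
    moreover obtain f where "rpow_comb n p \<nu> = cy (f \<star> ?r)" using rpow_comb_in_r[OF p0(2)] by blast
    ultimately have "cy ?b = cy ((f + g) \<star> ?r)" by (simp add: free_mult_linear cy_add)
    then have "Pi_class n ?b = \<one>\<^bsub>?G\<^esub>" using b Pi_class_eq_one_iff by blast
    then have "z [^]\<^bsub>?G\<^esub> p = \<one>\<^bsub>?G\<^esub>" using a by (simp add: Pi_class_pow)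
    then have "p ^ 2 dvd p" using G.pow_eq_id[OF z(1)] z(2) by simp
    then have "p ^ 2 \<le> p" using p0(2) by (rule dvd_imp_le)
    then show False using prime_gt_1_nat[OF assms(2)] by (simp add: power2_eq_square)
  qed
qed

end
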